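(* Let $ABCD\subset\mathbb{H}^2$ be a simple, nondegenerate, not necessarily convex hyperbolic quadrilateral. If the radian measures of all four internal angles of $ABCD$ lie in $\mathbb{Q}\pi$, then at least one of the four side lengths of $ABCD$ is transcendental over $\mathbb{Q}$.
   Context: $\mathbb{H}^2$ denotes the hyperbolic plane of constant Gaussian curvature $K=-1$; side lengths are hyperbolic lengths of the geodesic segments $AB$, $BC$, $CD$, $DA$. $\mathbb{Q}\pi$ denotes the set of rational multiples of $\pi$. A polygon is simple if its boundary does not intersect itself, and nondegenerate if every three consecutive vertices are noncollinear (not on a common geodesic). In particular, each internal angle has radian measure in $(0,\pi)\cup(\pi,2\pi)$. Transcendental means over $\mathbb{Q}$. *)

theory Defs
  imports "HOL-Analysis.Analysis"
begin

text \<open>The hyperbolic plane is the Poincare disc with the metric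
  \<open>4 |dz|^2 / (1 - |z|^2)^2\<close>, which has constant curvature \<open>-1\<close>;
  \<open>hdist\<close> is the associated distance.\<close>

definition hyp_plane :: "complex set" where
  "hyp_plane = ball 0 1"

definition hdist :: "complex \<Rightarrow> complex \<Rightarrow> real" where
  "hdist z w = arcosh (1 + 2 * (cmod (z - w))\<^sup>2 / ((1 - (cmod z)\<^sup>2) * (1 - (cmod w)\<^sup>2)))"

definition geodesic_line :: "complex set \<Rightarrow> bool" where
  "geodesic_line L \<longleftrightarrow>
     (\<exists>\<gamma> :: real \<Rightarrow> complex. range \<gamma> \<subseteq> hyp_plane \<and>
        (\<forall>s t. hdist (\<gamma> s) (\<gamma> t) = \<bar>s - t\<bar>) \<and> L = range \<gamma>)"

definition hcollinear :: "complex \<Rightarrow> complex \<Rightarrow> complex \<Rightarrow> bool" where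
  "hcollinear P Q R \<longleftrightarrow> (\<exists>L. geodesic_line L \<and> {P, Q, R} \<subseteq> L)"

text \<open>Geodesics are unique in the hyperbolic plane, so the geodesic segment is the set of
  points where the triangle inequality is an equality.\<close>

definition hsegment :: "complex \<Rightarrow> complex \<Rightarrow> complex set" where
  "hsegment P Q = {Z \<in> hyp_plane. hdist P Z + hdist Z Q = hdist P Q}"

definition quad_boundary :: "complex \<Rightarrow> complex \<Rightarrow> complex \<Rightarrow> complex \<Rightarrow> complex set" where
  "quad_boundary A B C D = hsegment A B \<union> hsegment B C \<union> hsegment C D \<union> hsegment D A"

text \<open>The complement of the disc is connected and unbounded in the complex plane, so
  the Euclidean \<open>inside\<close> of a closed curve in the disc is its hyperbolic inside.\<close>

definition quad_interior :: "complex \<Rightarrow> complex \<Rightarrow> complex \<Rightarrow> complex \<Rightarrow> complex set" where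
  "quad_interior A B C D = inside (quad_boundary A B C D)"

definition simple_quad :: "complex \<Rightarrow> complex \<Rightarrow> complex \<Rightarrow> complex \<Rightarrow> bool" where
  "simple_quad A B C D \<longleftrightarrow>
     distinct [A, B, C, D] \<and>
     hsegment A B \<inter> hsegment B C = {B} \<and>
     hsegment B C \<inter> hsegment C D = {C} \<and>
     hsegment C D \<inter> hsegment D A = {D} \<and>
     hsegment D A \<inter> hsegment A B = {A} \<and>
     hsegment A B \<inter> hsegment C D = {} \<and>
     hsegment B C \<inter> hsegment D A = {}"

definition nondegenerate_quad :: "complex \<Rightarrow> complex \<Rightarrow> complex \<Rightarrow> complex \<Rightarrow> bool" where
  "nondegenerate_quad A B C D \<longleftrightarrow>
     \<not> hcollinear A B C \<and> \<not> hcollinear B C D \<and> \<not> hcollinear C D A \<and> \<not> hcollinear D A B"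

text \<open>The direction at \<open>P\<close> of the geodesic from \<open>P\<close> to \<open>Q \<noteq> P\<close>, as a Euclidean unit vector.
  The disc automorphism \<open>\<lambda>z. (z - P) / (1 - cnj P * z)\<close> maps \<open>P\<close> to \<open>0\<close>, where geodesics are
  radial, and its derivative at \<open>P\<close> is a positive real.\<close>

definition hdirection :: "complex \<Rightarrow> complex \<Rightarrow> complex" where
  "hdirection P Q = sgn ((Q - P) / (1 - cnj P * Q))"

text \<open>The model is conformal, so hyperbolic angles are Euclidean angles between directions.\<close>

definition hangle :: "complex \<Rightarrow> complex \<Rightarrow> complex \<Rightarrow> real" where
  "hangle P Q R = arccos (hdirection Q P \<bullet> hdirection Q R)"

text \<open>The internal angle at the vertex \<open>Q\<close>, with neighbouring vertices \<open>P\<close> and \<open>R\<close>, of a polygon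
  with interior \<open>I\<close>: the two sides at \<open>Q\<close> bound a sector of angle \<open>hangle P Q R < pi\<close> and its
  complement; the first one is internal iff the points near \<open>Q\<close> in the bisecting direction of
  that sector lie in \<open>I\<close>.\<close>

definition internal_angle :: "complex set \<Rightarrow> complex \<Rightarrow> complex \<Rightarrow> complex \<Rightarrow> real" where
  "internal_angle I P Q R =
     (if \<forall>\<^sub>F s :: real in at_right 0. Q + s *\<^sub>R (hdirection Q P + hdirection Q R) \<in> I
      then hangle P Q R else 2 * pi - hangle P Q R)"

definition rational_multiples_of_pi :: "real set" where
  "rational_multiples_of_pi = {q * pi | q. q \<in> \<rat>}"

abbreviation transcendental :: "real \<Rightarrow> bool" where
  "transcendental x \<equiv> \<not> algebraic x"

end

theory Submission
  imports Defs "HOL-Computational_Algebra.Computational_Algebra" "HOL-Computational_Algebra.Field_as_Ring"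
begin

text \<open>
Suppose that the sides \<open>a = AB\<close>, \<open>b = BC\<close>, \<open>c = CD\<close>, \<open>d = DA\<close> are all algebraic. Let
\<open>\<alpha>\<close>, \<open>\<beta>\<close>, \<open>\<gamma>\<close>, \<open>\<delta>\<close> be the angles between consecutive sides at \<open>A\<close>, \<open>B\<close>, \<open>C\<close>, \<open>D\<close>. Each internal
angle is one of them or its complement to \<open>2 * pi\<close>, so their cosines are algebraic, and by
nondegeneracy they lie strictly between \<open>-1\<close> and 1. The law of cosines gives the diagonal \<open>BD\<close> in
two ways, and turning products into sums yields

  \<open>(1 - cos \<alpha>) cosh (d + a) + (1 + cos \<alpha>) cosh (d - a) =
   (1 - cos \<gamma>) cosh (b + c) + (1 + cos \<gamma>) cosh (b - c)\<close>.

By the Lindemann-Weierstrass theorem, hyperbolic cosines of distinct nonnegative algebraic numbers are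
linearly independent over the algebraic numbers. All coefficients here are positive, so the terms have to
match: \<open>{a, d} = {b, c}\<close>. The other diagonal gives \<open>{a, b} = {c, d}\<close>, and hence \<open>c = a\<close> and
\<open>d = b\<close> (\<open>common_diagonal_sides_agree\<close>).

A second relation excludes equal opposite sides. Four points of the hyperboloid model lie in a space of
dimension three, so their Gram matrix is singular. When opposite sides agree the matrix splits
into two blocks, and singularity of one of them (\<open>equal_opposite_sides_gram\<close>), combined with the law of
cosines, becomes

  \<open>(1 - cos \<alpha>) (1 - cos \<beta>) (cosh (a + b) + e) = (1 + cos \<alpha>) (1 + cos \<beta>) (cosh (a - b) + e)\<close>

with \<open>e = 1\<close> or \<open>e = -1\<close>. Since the coefficient of \<open>cosh (a + b)\<close> is not zero, this contradicts the
Lindemann-Weierstrass theorem once more (\<open>singular_gram_not_algebraic\<close>).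

The Lindemann-Weierstrass theorem is proved in two steps. Multiplying a
vanishing exponential sum by all its conjugates leads to one whose power series has rational coefficients;
the conjugates are formed with arbitrary permutations of the roots of a rational polynomial, so no Galois theory
enters (\<open>prod_conjugate_fps_rational\<close>). For rational coefficients, Hermite's operator produces numbers of
exponential size that, up to denominators of exponential size, are divisible by large factorials; such
numbers are zero, and this forces the whole series to be zero (\<open>vanishing_exp_sum_moments\<close>).
\<close>

section \<open>Power sums of the roots of a rational polynomial\<close>

unbundle no vec_syntax

lemma fps_geometric_mult: "(1 - fps_const x * fps_X) * Abs_fps (\<lambda>n. x ^ n) = (1 :: 'a :: field fps)"
proof (rule fps_ext)
  fix n show "((1 - fps_const x * fps_X) * Abs_fps (\<lambda>n. x ^ n)) $ n = (1 :: 'a fps) $ n"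
    by (cases n) (simp_all add: left_diff_distrib mult.assoc)
qed

text \<open>The logarithmic derivative of the product of the factors \<open>1 - \<rho> X\<close> is, up to sign, the
generating function \<open>S\<close> of the power sums. Clearing the denominator turns this into a recurrence
for the coefficients of \<open>S\<close> whose leading coefficient is 1: these are Newton's identities.\<close>

lemma power_sums_rational_fps:
  fixes R :: "complex set"
  assumes fin: "finite R"
    and rat: "\<And>n. fps_nth (\<Prod>\<rho>\<in>R. 1 - fps_const \<rho> * fps_X) n \<in> \<rat>"
  shows "(\<Sum>\<rho>\<in>R. \<rho> ^ Suc n) \<in> \<rat>"
proof -
  define f where "f = (\<Prod>\<rho>\<in>R. 1 - fps_const \<rho> * fps_X :: complex fps)"
  define S where "S = (\<Sum>\<rho>\<in>R. fps_const \<rho> * Abs_fps (\<lambda>n. \<rho> ^ n))"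
  have S_nth: "S $ n = (\<Sum>\<rho>\<in>R. \<rho> ^ Suc n)" for n
    by (simp add: S_def fps_sum_nth)
  have f_rat: "f $ n \<in> \<rat>" for n using rat by (simp add: f_def)
  have f0: "f $ 0 = 1"
    unfolding f_def using fin by (induction R rule: finite_induct) simp_all
  have deriv: "fps_deriv f = - (f * S)"
    unfolding f_def S_def using fin
  proof (induction R rule: finite_induct)
    case (insert x F)
    let ?g = "Abs_fps (\<lambda>n. x ^ n)" and ?l = "1 - fps_const x * fps_X :: complex fps"
    let ?P = "\<Prod>\<rho>\<in>F. 1 - fps_const \<rho> * fps_X :: complex fps"
    let ?S = "\<Sum>\<rho>\<in>F. fps_const \<rho> * Abs_fps (\<lambda>n. \<rho> ^ n)"
    have "fps_deriv (\<Prod>\<rho>\<in>insert x F. 1 - fps_const \<rho> * fps_X) = 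
        ?l * - (?P * ?S) + - fps_const x * ?P"
      using insert by simp
    also have "- fps_const x * ?P = - (?l * ?g) * fps_const x * ?P"
      by (simp add: fps_geometric_mult)
    finally show ?case using insert by (simp add: algebra_simps)
  qed simp
  have "S $ n \<in> \<rat>" for n
  proof (induction n rule: less_induct)
    case (less n)
    have "- (fps_deriv f $ n) = (f * S) $ n" by (simp add: deriv)
    also have "\<dots> = (\<Sum>i=0..n. f $ i * S $ (n - i))" by (simp add: fps_mult_nth)
    also have "\<dots> = S $ n + (\<Sum>i=Suc 0..n. f $ i * S $ (n - i))"
      by (subst sum.atLeast_Suc_atMost) (simp_all add: f0)
    finally have "S $ n = - (fps_deriv f $ n) - (\<Sum>i=Suc 0..n. f $ i * S $ (n - i))"
      by simp
    moreover have "fps_deriv f $ n \<in> \<rat>" using f_rat by (simp add: Rats_mult)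
    moreover have "(\<Sum>i=Suc 0..n. f $ i * S $ (n - i)) \<in> \<rat>"
      using less by (intro Rats_sum Rats_mult f_rat) auto
    ultimately show ?case by (metis Rats_diff Rats_minus_iff)
  qed
  then show ?thesis by (simp add: S_nth)
qed

text \<open>Dividing by the greatest common divisor with the derivative removes multiple roots, and the
division takes place over the rationals. Bezout's identity transfers to the complex numbers,
so the roots there are unaffected.\<close>

lemma exists_rational_rsquarefree_poly:
  fixes P :: "rat poly"
  assumes "P \<noteq> 0"
  obtains Q :: "rat poly" where "rsquarefree (map_poly of_rat Q :: complex poly)"
    "\<And>x :: complex. poly (map_poly of_rat Q) x = 0 \<longleftrightarrow> poly (map_poly of_rat P) x = 0"
proof (cases "pderiv P = 0")
  case True
  then obtain h where h: "P = [:h:]" using pderiv_iszero by blast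
  show ?thesis
    by (rule that[of P]) (use h assms in \<open>auto simp: rsquarefree_def map_poly_pCons order_0I\<close>)
next
  case False
  let ?c = "map_poly of_rat :: rat poly \<Rightarrow> complex poly"
  define d where "d = gcd P (pderiv P)"
  obtain q where q: "P = d * q" unfolding d_def by (meson dvdE gcd_dvd1)
  obtain e where e: "pderiv P = d * e" unfolding d_def by (meson dvdE gcd_dvd2)
  obtain r s where rs: "d = r * P + s * pderiv P"
    unfolding d_def by (metis bezout_coefficients_fst_snd)
  have hom: "?c (x * y) = ?c x * ?c y" "?c (x + y) = ?c x + ?c y" "?c (pderiv x) = pderiv (?c x)" for x y
    by (intro poly_eqI; simp add: coeff_map_poly coeff_mult coeff_pderiv of_rat_sum of_rat_mult of_rat_add)+
  have "pderiv (?c P) \<noteq> 0"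
    using False by (simp add: map_poly_eq_0_iff flip: hom(3))
  moreover have "?c P = ?c q * ?c d" using q by (simp add: hom mult.commute)
  moreover have "pderiv (?c P) = ?c e * ?c d" using e by (simp flip: hom(3) add: hom(1,2) mult.commute)
  moreover have "?c d = ?c r * ?c P + ?c s * pderiv (?c P)" by (subst rs) (simp add: hom)
  ultimately have "rsquarefree (?c q) \<and> (\<forall>a. poly (?c q) a = 0 \<longleftrightarrow> poly (?c P) a = 0)"
    by (rule poly_squarefree_decomp)
  with that[of q] show ?thesis by blast
qed

lemma power_sums_rational:
  fixes R :: "complex set"
  assumes "finite R" and "\<And>n. coeff (\<Prod>\<rho>\<in>R. [:-\<rho>, 1:]) n \<in> \<rat>"
  shows "(\<Sum>\<rho>\<in>R. \<rho> ^ n) \<in> \<rat>"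
proof (cases n)
  case (Suc m)
  have refl: "reflect_poly [:-\<rho>, 1:] = [:1, -\<rho>:]" for \<rho> :: complex
    by (intro poly_eqI) (auto simp: coeff_reflect_poly coeff_pCons split: nat.splits)
  have lin: "fps_of_poly [:1, -\<rho>:] = 1 - fps_const \<rho> * fps_X" for \<rho> :: complex
    by (rule fps_ext) (auto simp: coeff_pCons split: nat.splits)
  have "(\<Prod>\<rho>\<in>R. 1 - fps_const \<rho> * fps_X) = fps_of_poly (reflect_poly (\<Prod>\<rho>\<in>R. [:-\<rho>, 1:]))"
    by (simp add: reflect_poly_prod refl lin fps_of_poly_prod)
  then have "fps_nth (\<Prod>\<rho>\<in>R. 1 - fps_const \<rho> * fps_X) n \<in> \<rat>" for n
    using assms(2) by (simp add: coeff_reflect_poly)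
  then have "(\<Sum>\<rho>\<in>R. \<rho> ^ Suc m) \<in> \<rat>"
    by (intro power_sums_rational_fps assms(1))
  with Suc show ?thesis by simp
qed simp

text \<open>This provides the finite set \<open>R\<close> whose permutations stand in for Galois groups below: the nonzero
roots, taken without multiplicity, of a rational polynomial that vanishes on \<open>X\<close>. Leaving out 0
costs nothing for the power sums and ensures that a permutation of \<open>R\<close> turns a nonzero number
into a nonzero one.\<close>

lemma algebraic_closed_root_set:
  fixes X :: "complex set"
  assumes "finite X" and alg: "\<And>x. x \<in> X \<Longrightarrow> algebraic x"
  obtains R where "finite R" "0 \<notin> R" "X - {0} \<subseteq> R" "\<forall>x\<in>R. algebraic x"
    "\<forall>n. (\<Sum>\<rho>\<in>R. \<rho> ^ n) \<in> \<rat>"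
proof -
  let ?c = "map_poly of_rat :: rat poly \<Rightarrow> complex poly"
  have hom: "?c (x * y) = ?c x * ?c y" for x y
    by (intro poly_eqI) (simp add: coeff_map_poly coeff_mult of_rat_sum of_rat_mult)
  have "\<exists>P. P \<noteq> 0 \<and> (\<forall>x\<in>X. poly (?c P) x = 0)"
    using assms
  proof (induction X rule: finite_induct)
    case empty
    show ?case by (rule exI[of _ 1]) simp
  next
    case (insert x F)
    then obtain P where P: "P \<noteq> 0" "\<forall>x\<in>F. poly (?c P) x = 0" by auto
    have "algebraic x" using insert.prems by blast
    then obtain p where p: "\<And>i. coeff p i \<in> \<rat>" "p \<noteq> 0" "poly p x = 0"
      unfolding algebraic_altdef by blast
    obtain p' where p': "p = ?c p'" using ratpolyE[of p] p(1) by blast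
    have "p' \<noteq> 0" using p(2) p' by auto
    with P p(3) p' show ?case
      by (intro exI[of _ "p' * P"]) (simp add: hom)
  qed
  then obtain P where P: "P \<noteq> 0" "\<And>x. x \<in> X \<Longrightarrow> poly (?c P) x = 0" by blast
  obtain Q where Q: "rsquarefree (?c Q)" "\<And>x. poly (?c Q) x = 0 \<longleftrightarrow> poly (?c P) x = 0"
    using exists_rational_rsquarefree_poly[OF P(1)] by blast
  define q where "q = ?c Q"
  have q0: "q \<noteq> 0" using Q(1) by (auto simp: rsquarefree_def q_def)
  define Z where "Z = {z. poly q z = 0}"
  have finZ: "finite Z" unfolding Z_def using q0 by (rule poly_roots_finite)
  have decomp: "smult (lead_coeff q) (\<Prod>z\<in>Z. [:-z, 1:]) = q"
    unfolding Z_def using Q(1) by (intro complex_poly_decompose_rsquarefree) (simp add: q_def)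
  have "coeff (\<Prod>z\<in>Z. [:-z, 1:]) n \<in> \<rat>" for n
  proof -
    have "lead_coeff q * coeff (\<Prod>z\<in>Z. [:-z, 1:]) n = coeff q n"
      by (subst (3) decomp[symmetric]) simp
    then have "coeff (\<Prod>z\<in>Z. [:-z, 1:]) n = coeff q n / lead_coeff q"
      using q0 by (simp add: field_simps)
    then show ?thesis by (simp add: q_def coeff_map_poly)
  qed
  note power = power_sums_rational[OF finZ this]
  show ?thesis
  proof (rule that[of "Z - {0}"])
    show "X - {0} \<subseteq> Z - {0}" using P(2) Q(2) by (auto simp: Z_def q_def)
    show "\<forall>x\<in>Z - {0}. algebraic x"
    proof
      fix x assume "x \<in> Z - {0}"
      then show "algebraic x"
        unfolding algebraic_altdef
        by (intro exI[of _ q]) (use q0 in \<open>auto simp: Z_def q_def coeff_map_poly\<close>)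
    qed
    show "\<forall>n. (\<Sum>\<rho>\<in>Z - {0}. \<rho> ^ n) \<in> \<rat>"
    proof
      fix n show "(\<Sum>\<rho>\<in>Z - {0}. \<rho> ^ n) \<in> \<rat>"
      proof (cases "n = 0")
        case False
        then have "(\<Sum>\<rho>\<in>Z - {0}. \<rho> ^ n) = (\<Sum>\<rho>\<in>Z. \<rho> ^ n)"
          using finZ by (intro sum.mono_neutral_left) auto
        then show ?thesis using power by simp
      qed simp
    qed
  qed (use finZ in auto)
qed

section \<open>Averages and norms over permutations of roots\<close>

lemma sum_distinct_lists_Suc:
  fixes f :: "'a list \<Rightarrow> 'b :: comm_monoid_add"
  assumes "finite R"
  shows "(\<Sum>xs | length xs = Suc n \<and> distinct xs \<and> set xs \<subseteq> R. f xs) =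
    (\<Sum>xs | length xs = n \<and> distinct xs \<and> set xs \<subseteq> R. \<Sum>x\<in>R - set xs. f (x # xs))"
proof -
  have fin: "finite {xs. length xs = n \<and> distinct xs \<and> set xs \<subseteq> R}"
    by (rule finite_subset[OF _ finite_lists_length_eq[OF assms, of n]]) auto
  have "(\<Sum>xs | length xs = Suc n \<and> distinct xs \<and> set xs \<subseteq> R. f xs) =
      (\<Sum>(xs, x)\<in>(SIGMA xs:{xs. length xs = n \<and> distinct xs \<and> set xs \<subseteq> R}. R - set xs). f (x # xs))"
    by (rule sum.reindex_bij_witness[of _ "\<lambda>(xs, x). x # xs" "\<lambda>xs. (tl xs, hd xs)"])
       (auto simp: length_Suc_conv)
  then show ?thesis using fin assms by (simp add: sum.Sigma)
qed

text \<open>Summing over the first entry of the list is a sum over \<open>R\<close> minus the terms in which that entry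
repeats a later one. The former contributes a power sum; in the latter the exponent is
absorbed by the repeated entry. So induction on the length expresses everything by power sums.\<close>

lemma sum_monomials_over_distinct_lists_rational:
  fixes R :: "'a :: field_char_0 set"
  assumes fin: "finite R" and power: "\<And>n. (\<Sum>\<rho>\<in>R. \<rho> ^ n) \<in> \<rat>"
  shows "(\<Sum>xs | length xs = n \<and> distinct xs \<and> set xs \<subseteq> R. \<Prod>i<n. (xs ! i) ^ e i) \<in> \<rat>"
proof (induction n arbitrary: e)
  case 0
  have "{xs. xs = [] \<and> distinct xs \<and> set xs \<subseteq> R} = {[]}" by auto
  then show ?case by simp
next
  case (Suc n)
  let ?D = "{xs. length xs = n \<and> distinct xs \<and> set xs \<subseteq> R}"
  define f where "f e xs = (\<Prod>i<n. (xs ! i) ^ e i)" for e :: "nat \<Rightarrow> nat" and xs :: "'a list"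
  define e' where "e' = (\<lambda>i. e (Suc i))"
  have split: "(\<Sum>x\<in>R - set xs. x ^ e 0 * f e' xs) =
      (\<Sum>x\<in>R. x ^ e 0) * f e' xs - (\<Sum>j<n. f (e'(j := e' j + e 0)) xs)" if "xs \<in> ?D" for xs
  proof -
    have "(\<Sum>x\<in>R - set xs. x ^ e 0) = (\<Sum>x\<in>R. x ^ e 0) - (\<Sum>x\<in>set xs. x ^ e 0)"
      using that fin by (intro sum_diff) auto
    also have "(\<Sum>x\<in>set xs. x ^ e 0) = (\<Sum>j<n. (xs ! j) ^ e 0)"
      using that by (intro sum.reindex_bij_betw[symmetric] bij_betw_nth) auto
    finally have "(\<Sum>x\<in>R - set xs. x ^ e 0 * f e' xs) =
        (\<Sum>x\<in>R. x ^ e 0) * f e' xs - (\<Sum>j<n. (xs ! j) ^ e 0 * f e' xs)"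
      by (simp add: left_diff_distrib flip: sum_distrib_right)
    also have "(\<Sum>j<n. (xs ! j) ^ e 0 * f e' xs) = (\<Sum>j<n. f (e'(j := e' j + e 0)) xs)"
    proof (rule sum.cong)
      fix j assume j: "j \<in> {..<n}"
      have "f (e'(j := e' j + e 0)) xs = (xs ! j) ^ (e' j + e 0) * (\<Prod>i\<in>{..<n}-{j}. (xs ! i) ^ e' i)"
        unfolding f_def using j by (subst prod.remove[of _ j]) auto
      also have "\<dots> = (xs ! j) ^ e 0 * f e' xs"
        unfolding f_def using j by (subst (2) prod.remove[of _ j]) (auto simp: power_add)
      finally show "(xs ! j) ^ e 0 * f e' xs = f (e'(j := e' j + e 0)) xs" by simp
    qed auto
    finally show ?thesis .
  qed
  have "(\<Sum>xs | length xs = Suc n \<and> distinct xs \<and> set xs \<subseteq> R. \<Prod>i<Suc n. (xs ! i) ^ e i) =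
      (\<Sum>xs\<in>?D. \<Sum>x\<in>R - set xs. x ^ e 0 * f e' xs)"
    by (simp add: sum_distinct_lists_Suc[OF fin] prod.lessThan_Suc_shift f_def e'_def del: prod.lessThan_Suc)
  also have "\<dots> = (\<Sum>xs\<in>?D. (\<Sum>x\<in>R. x ^ e 0) * f e' xs - (\<Sum>j<n. f (e'(j := e' j + e 0)) xs))"
    by (intro sum.cong split refl)
  also have "\<dots> = (\<Sum>x\<in>R. x ^ e 0) * (\<Sum>xs\<in>?D. f e' xs) -
      (\<Sum>j<n. \<Sum>xs\<in>?D. f (e'(j := e' j + e 0)) xs)"
    by (simp add: sum_subtractf sum_distrib_left sum.swap[of _ "{..<n}" ?D])
  also have "\<dots> \<in> \<rat>"
    unfolding f_def by (intro Rats_diff Rats_mult Rats_sum power Suc.IH)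
  finally show ?case .
qed

lemma bij_betw_permutations_distinct_lists:
  assumes "distinct rs"
  shows "bij_betw (\<lambda>\<sigma>. map \<sigma> rs) {\<sigma>. \<sigma> permutes set rs}
           {xs. length xs = length rs \<and> distinct xs \<and> set xs \<subseteq> set rs}"
proof (rule bij_betwI')
  fix \<sigma> \<tau> assume "\<sigma> \<in> {\<sigma>. \<sigma> permutes set rs}" "\<tau> \<in> {\<sigma>. \<sigma> permutes set rs}"
  then show "map \<sigma> rs = map \<tau> rs \<longleftrightarrow> \<sigma> = \<tau>"
    by (auto simp: fun_eq_iff permutes_def)
next
  fix \<sigma> assume "\<sigma> \<in> {\<sigma>. \<sigma> permutes set rs}"
  then show "map \<sigma> rs \<in> {xs. length xs = length rs \<and> distinct xs \<and> set xs \<subseteq> set rs}"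
    using assms by (auto simp: distinct_map permutes_inj_on permutes_in_image)
next
  fix xs assume xs: "xs \<in> {xs. length xs = length rs \<and> distinct xs \<and> set xs \<subseteq> set rs}"
  then have set_xs: "set xs = set rs"
    by (intro card_subset_eq) (simp_all add: distinct_card assms)
  define n where "n = length rs"
  have b1: "bij_betw ((!) rs) {..<n} (set rs)" and b2: "bij_betw ((!) xs) {..<n} (set rs)"
    using assms xs set_xs by (auto intro!: bij_betw_nth simp: n_def)
  define \<sigma> where "\<sigma> = (\<lambda>x. if x \<in> set rs then xs ! (inv_into {..<n} ((!) rs) x) else x)"
  have "bij_betw (((!) xs) \<circ> inv_into {..<n} ((!) rs)) (set rs) (set rs)"
    using bij_betw_inv_into[OF b1] b2 by (rule bij_betw_trans)
  then have "bij_betw \<sigma> (set rs) (set rs)"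
    by (rule bij_betw_cong[THEN iffD1, rotated]) (simp add: \<sigma>_def)
  then have "\<sigma> permutes set rs" by (rule bij_imp_permutes) (simp add: \<sigma>_def)
  moreover have "xs = map \<sigma> rs"
  proof (rule nth_equalityI)
    show "length xs = length (map \<sigma> rs)" using xs by simp
    fix i assume "i < length xs"
    then have "i < n" using xs by (simp add: n_def)
    then show "xs ! i = map \<sigma> rs ! i"
      using b1 by (simp add: \<sigma>_def n_def bij_betw_def inv_into_f_f)
  qed
  ultimately show "\<exists>\<sigma>\<in>{\<sigma>. \<sigma> permutes set rs}. xs = map \<sigma> rs" by blast
qed

lemma sum_monomials_over_permutations_rational:
  fixes R :: "'a :: field_char_0 set"
  assumes fin: "finite R" and power: "\<And>n. (\<Sum>\<rho>\<in>R. \<rho> ^ n) \<in> \<rat>"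
  shows "(\<Sum>\<sigma> | \<sigma> permutes R. \<Prod>x\<in>R. \<sigma> x ^ e x) \<in> \<rat>"
proof -
  obtain rs where rs: "set rs = R" "distinct rs" using finite_distinct_list[OF fin] by blast
  have "(\<Sum>\<sigma> | \<sigma> permutes R. \<Prod>x\<in>R. \<sigma> x ^ e x) =
      (\<Sum>\<sigma> | \<sigma> permutes R. \<Prod>i<length rs. (map \<sigma> rs ! i) ^ e (rs ! i))"
  proof (rule sum.cong)
    fix \<sigma> :: "'a \<Rightarrow> 'a"
    have "(\<Prod>x\<in>R. \<sigma> x ^ e x) = (\<Prod>i<length rs. \<sigma> (rs ! i) ^ e (rs ! i))"
      using rs by (intro prod.reindex_bij_betw[symmetric] bij_betw_nth) auto
    then show "(\<Prod>x\<in>R. \<sigma> x ^ e x) = (\<Prod>i<length rs. (map \<sigma> rs ! i) ^ e (rs ! i))"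
      by simp
  qed auto
  also have "\<dots> = (\<Sum>xs | length xs = length rs \<and> distinct xs \<and> set xs \<subseteq> R.
      \<Prod>i<length rs. (xs ! i) ^ e (rs ! i))"
    using bij_betw_permutations_distinct_lists[OF rs(2)] unfolding rs(1)
    by (rule sum.reindex_bij_betw)
  also have "\<dots> \<in> \<rat>"
    by (rule sum_monomials_over_distinct_lists_rational[OF fin power])
  finally show ?thesis .
qed

text \<open>The polynomial expressions with rational coefficients in the elements of \<open>R\<close>, seen as functions
of the permutation \<open>\<sigma>\<close> that is applied to these elements. Normal forms, instead of closure under
products, make the sum over all permutations accessible.\<close>

inductive perm_poly :: "'a :: field_char_0 set \<Rightarrow> (('a \<Rightarrow> 'a) \<Rightarrow> 'a) \<Rightarrow> bool" for R where
  monomial: "q \<in> \<rat> \<Longrightarrow> perm_poly R (\<lambda>\<sigma>. q * (\<Prod>x\<in>R. \<sigma> x ^ e x))"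
| add: "perm_poly R \<phi> \<Longrightarrow> perm_poly R \<psi> \<Longrightarrow> perm_poly R (\<lambda>\<sigma>. \<phi> \<sigma> + \<psi> \<sigma>)"

lemma perm_poly_const: "q \<in> \<rat> \<Longrightarrow> perm_poly R (\<lambda>\<sigma>. q)"
  using perm_poly.monomial[of q R "\<lambda>_. 0"] by simp

lemma perm_poly_apply:
  assumes "finite R" "x \<in> R"
  shows "perm_poly R (\<lambda>\<sigma>. \<sigma> x)"
proof -
  have "perm_poly R (\<lambda>\<sigma>. 1 * (\<Prod>y\<in>R. \<sigma> y ^ (if y = x then 1 else 0)))"
    by (rule perm_poly.monomial) simp
  then show ?thesis using assms by (simp add: if_distrib[of "power _"] prod.delta cong: if_cong)
qed

lemma perm_poly_mult:
  assumes "perm_poly R \<phi>" "perm_poly R \<psi>"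
  shows "perm_poly R (\<lambda>\<sigma>. \<phi> \<sigma> * \<psi> \<sigma>)"
  using assms(1)
proof (induction rule: perm_poly.induct)
  case (monomial q e)
  note q = this
  show ?case using assms(2)
  proof (induction rule: perm_poly.induct)
    case (monomial r d)
    have "perm_poly R (\<lambda>\<sigma>. (q * r) * (\<Prod>x\<in>R. \<sigma> x ^ (e x + d x)))"
      using q monomial by (intro perm_poly.monomial Rats_mult)
    then show ?case by (simp add: power_add prod.distrib mult_ac)
  next
    case (add \<phi> \<psi>)
    from perm_poly.add[OF add.IH] show ?case by (simp add: distrib_left)
  qed
next
  case (add \<phi> \<psi>)
  from perm_poly.add[OF add.IH] show ?case by (simp add: distrib_right)
qed

lemma perm_poly_sum:
  "(\<And>i. i \<in> I \<Longrightarrow> perm_poly R (\<phi> i)) \<Longrightarrow> perm_poly R (\<lambda>\<sigma>. \<Sum>i\<in>I. \<phi> i \<sigma>)"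
  by (induction I rule: infinite_finite_induct)
     (auto intro: perm_poly.add perm_poly_const)

lemma perm_poly_power: "perm_poly R \<phi> \<Longrightarrow> perm_poly R (\<lambda>\<sigma>. \<phi> \<sigma> ^ n)"
  by (induction n) (auto intro: perm_poly_mult perm_poly_const)

lemma perm_poly_translate:
  assumes "perm_poly R \<phi>" "\<pi> permutes R"
  shows "perm_poly R (\<lambda>\<sigma>. \<phi> (\<sigma> \<circ> \<pi>))"
  using assms(1)
proof (induction rule: perm_poly.induct)
  case (monomial q e)
  have eq: "(\<Prod>x\<in>R. (\<sigma> \<circ> \<pi>) x ^ e x) = (\<Prod>x\<in>R. \<sigma> x ^ e (inv \<pi> x))" for \<sigma>
    using prod.permute[OF assms(2), of "\<lambda>x. \<sigma> x ^ e (inv \<pi> x)"] assms(2)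
    by (simp add: o_def permutes_inverses)
  show ?case unfolding eq using monomial by (rule perm_poly.monomial)
next
  case (add \<phi> \<psi>)
  then show ?case by (intro perm_poly.add)
qed

lemma sum_perm_poly_rational:
  assumes "perm_poly R \<phi>" and "finite R" "\<And>n. (\<Sum>\<rho>\<in>R. \<rho> ^ n) \<in> \<rat>"
  shows "(\<Sum>\<sigma> | \<sigma> permutes R. \<phi> \<sigma>) \<in> \<rat>"
  using assms(1)
proof (induction rule: perm_poly.induct)
  case (monomial q e)
  then show ?case
    unfolding sum_distrib_left[symmetric]
    by (intro Rats_mult sum_monomials_over_permutations_rational assms)
qed (auto simp: sum.distrib)

text \<open>The norm argument. Translating by \<open>\<sigma>\<close> only reorders the factors, so as a function of \<open>\<sigma>\<close> the
product \<open>G \<sigma>\<close> is constant; being a polynomial expression it has a rational sum over all \<open>\<sigma>\<close>,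
and that sum is the number of permutations times the constant.\<close>

lemma prod_conjugate_fps_rational:
  fixes F :: "('a :: field_char_0 \<Rightarrow> 'a) \<Rightarrow> 'a fps"
  assumes F: "\<And>n. perm_poly R (\<lambda>\<sigma>. fps_nth (F \<sigma>) n)"
    and fin: "finite R" and power: "\<And>n. (\<Sum>\<rho>\<in>R. \<rho> ^ n) \<in> \<rat>"
  shows "fps_nth (\<Prod>\<sigma> | \<sigma> permutes R. F \<sigma>) n \<in> \<rat>"
proof -
  let ?S = "{\<sigma>. \<sigma> permutes R}"
  have finS: "finite ?S" using fin by (rule finite_permutations)
  define G where "G \<sigma> = (\<Prod>\<pi>\<in>?S. F (\<sigma> \<circ> \<pi>))" for \<sigma>
  have "perm_poly R (\<lambda>\<sigma>. fps_nth (\<Prod>\<pi>\<in>T. F (\<sigma> \<circ> \<pi>)) n)" if "T \<subseteq> ?S" "finite T" for T n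
    using that(2,1)
  proof (induction T arbitrary: n rule: finite_induct)
    case empty
    show ?case by (cases "n = 0") (simp_all add: perm_poly_const)
  next
    case (insert \<pi> T)
    then show ?case
      by (auto simp: fps_mult_nth o_def
          intro!: perm_poly_sum perm_poly_mult perm_poly_translate[OF F, unfolded o_def])
  qed
  then have "perm_poly R (\<lambda>\<sigma>. fps_nth (G \<sigma>) n)"
    unfolding G_def using finS by blast
  then have "(\<Sum>\<sigma>\<in>?S. fps_nth (G \<sigma>) n) \<in> \<rat>"
    using fin power by (rule sum_perm_poly_rational)
  moreover have "G \<sigma> = (\<Prod>\<pi>\<in>?S. F \<pi>)" if "\<sigma> \<in> ?S" for \<sigma>
    unfolding G_def
  proof (rule prod.reindex_bij_betw)
    have "\<sigma> permutes R" using that by simp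
    then show "bij_betw (\<lambda>\<pi>. \<sigma> \<circ> \<pi>) ?S ?S"
      by (intro bij_betwI[where g = "\<lambda>\<pi>. inv \<sigma> \<circ> \<pi>"] funcsetI)
         (auto simp: permutes_compose permutes_inv o_assoc permutes_inv_o)
  qed
  ultimately have "of_nat (card ?S) * fps_nth (\<Prod>\<pi>\<in>?S. F \<pi>) n \<in> \<rat>"
    by simp
  then have "of_nat (card ?S) * fps_nth (\<Prod>\<pi>\<in>?S. F \<pi>) n / of_nat (card ?S) \<in> \<rat>"
    by (intro Rats_divide) auto
  moreover have "card ?S \<noteq> 0"
    using finS permutes_id[of R] by (metis card_0_eq empty_iff mem_Collect_eq)
  ultimately show ?thesis by simp
qed

text \<open>The product of the factors \<open>X - \<phi> \<sigma>\<close> over all permutations is a rational polynomial, again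
by the norm argument, and \<open>\<phi> id\<close> is one of its roots. That sums and products of algebraic numbers are
algebraic is a special case.\<close>

lemma algebraic_perm_poly_id:
  fixes R :: "complex set"
  assumes \<phi>: "perm_poly R \<phi>"
    and fin: "finite R" and power: "\<And>n. (\<Sum>\<rho>\<in>R. \<rho> ^ n) \<in> \<rat>"
  shows "algebraic (\<phi> id)"
proof -
  let ?S = "{\<sigma>. \<sigma> permutes R}"
  have finS: "finite ?S" using fin by (rule finite_permutations)
  define p where "p = (\<Prod>\<sigma>\<in>?S. [:-\<phi> \<sigma>, 1:])"
  have "perm_poly R (\<lambda>\<sigma>. fps_nth (fps_of_poly [:-\<phi> \<sigma>, 1:]) n)" for n
    using perm_poly_mult[OF perm_poly_const[of "-1"] \<phi>]
    by (cases n) (auto simp: coeff_pCons intro: perm_poly_const split: nat.splits)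
  from prod_conjugate_fps_rational[OF this fin power]
  have "coeff p n \<in> \<rat>" for n
    unfolding p_def by (simp flip: fps_of_poly_prod)
  moreover have "p \<noteq> 0" using finS by (simp add: p_def)
  moreover have "poly p (\<phi> id) = 0"
    using finS permutes_id[of R] by (force simp: p_def poly_prod)
  ultimately show ?thesis unfolding algebraic_altdef by blast
qed

lemma algebraic_add_mult_complex:
  fixes x y :: complex
  assumes "algebraic x" "algebraic y"
  shows "algebraic (x + y)" "algebraic (x * y)"
proof -
  have "finite {x, y}" "\<And>z. z \<in> {x, y} \<Longrightarrow> algebraic z" using assms by auto
  then obtain R where R: "finite R" "0 \<notin> R" "{x, y} - {0} \<subseteq> R"
      "\<forall>z\<in>R. algebraic z" and power: "\<forall>n. (\<Sum>\<rho>\<in>R. \<rho> ^ n) \<in> \<rat>"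
    by (rule algebraic_closed_root_set)
  note power = power[rule_format]
  have coord: "\<exists>\<phi>. perm_poly R \<phi> \<and> \<phi> id = z" if "z \<in> {x, y}" for z
  proof (cases "z = 0")
    case True
    then show ?thesis using perm_poly_const[of 0 R] by (intro exI[of _ "\<lambda>_. 0"]) auto
  next
    case False
    then have "z \<in> R" using that R by auto
    with perm_poly_apply[OF R(1)] show ?thesis by (intro exI[of _ "\<lambda>\<sigma>. \<sigma> z"]) auto
  qed
  obtain \<phi> \<psi> where \<phi>: "perm_poly R \<phi>" "\<phi> id = x" and \<psi>: "perm_poly R \<psi>" "\<psi> id = y"
    using coord by blast
  show "algebraic (x + y)"
    using algebraic_perm_poly_id[OF perm_poly.add[OF \<phi>(1) \<psi>(1)] R(1) power] \<phi>(2) \<psi>(2) by simp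
  show "algebraic (x * y)"
    using algebraic_perm_poly_id[OF perm_poly_mult[OF \<phi>(1) \<psi>(1)] R(1) power] \<phi>(2) \<psi>(2) by simp
qed

section \<open>Vanishing exponential sums with rational power series coefficients\<close>

text \<open>Hermite's operator: the formal integral of \<open>exp (-t) p(x + t)\<close> over positive \<open>t\<close>.\<close>

definition deriv_sum :: "'a :: field_char_0 poly \<Rightarrow> 'a poly" where
  "deriv_sum p = (\<Sum>j\<le>degree p. (pderiv ^^ j) p)"

lemma higher_pderiv_eq_0: "degree p < j \<Longrightarrow> (pderiv ^^ j) p = 0"
  by (rule poly_eqI) (simp add: coeff_higher_pderiv coeff_eq_0)

lemma deriv_sum_altdef: "degree p \<le> n \<Longrightarrow> deriv_sum p = (\<Sum>j\<le>n. (pderiv ^^ j) p)"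
  unfolding deriv_sum_def
  by (intro sum.mono_neutral_left) (auto simp: higher_pderiv_eq_0)

lemma deriv_sum_add: "deriv_sum (p + q) = deriv_sum p + deriv_sum q"
proof -
  define n where "n = max (degree p) (degree q)"
  have "degree p \<le> n" "degree q \<le> n" "degree (p + q) \<le> n"
    unfolding n_def by (auto intro: degree_add_le_max)
  then show ?thesis
    by (simp add: deriv_sum_altdef higher_pderiv_add sum.distrib)
qed

lemma deriv_sum_smult: "deriv_sum (smult c p) = smult c (deriv_sum p)"
  using degree_smult_le[of c p]
  by (intro poly_eqI)
     (simp add: deriv_sum_altdef[of _ "degree p"] higher_pderiv_smult coeff_sum sum_distrib_left)

text \<open>In other words, the operator inverts \<open>p \<mapsto> p - p'\<close>.\<close>

lemma deriv_sum_unfold: "deriv_sum p = p + deriv_sum (pderiv p)"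
proof -
  have "deriv_sum p = (\<Sum>j\<le>Suc (degree p). (pderiv ^^ j) p)"
    by (rule deriv_sum_altdef) simp
  also have "\<dots> = p + (\<Sum>j\<le>degree p. (pderiv ^^ Suc j) p)"
    by (subst sum.atMost_Suc_shift) simp
  also have "(\<Sum>j\<le>degree p. (pderiv ^^ Suc j) p) = (\<Sum>j\<le>degree p. (pderiv ^^ j) (pderiv p))"
    by (simp only: funpow_Suc_right o_def)
  also have "\<dots> = deriv_sum (pderiv p)"
    by (rule deriv_sum_altdef[symmetric]) (simp add: degree_pderiv)
  finally show ?thesis .
qed

text \<open>Monomials produce the truncations of the exponential series, which is the link between
\<open>deriv_sum\<close> and the exponential function.\<close>

lemma poly_deriv_sum_monom:
  "poly (deriv_sum (monom 1 n)) x = fact n * (\<Sum>k\<le>n. x ^ k / fact k)"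
proof (induction n)
  case 0
  show ?case by (simp add: deriv_sum_def)
next
  case (Suc n)
  have "pderiv (monom 1 (Suc n)) = smult (of_nat (Suc n)) (monom (1 :: 'a) n)"
    by (simp add: pderiv_monom smult_monom)
  then have "poly (deriv_sum (monom 1 (Suc n))) x =
      x ^ Suc n + of_nat (Suc n) * poly (deriv_sum (monom 1 n)) x"
    by (subst deriv_sum_unfold) (simp add: deriv_sum_smult poly_monom del: of_nat_Suc)
  also have "\<dots> = x ^ Suc n + fact (Suc n) * (\<Sum>k\<le>n. x ^ k / fact k)"
    by (simp add: Suc.IH mult.assoc del: of_nat_Suc)
  also have "\<dots> = fact (Suc n) * (\<Sum>k\<le>Suc n. x ^ k / fact k)"
    by (simp add: distrib_left del: fact_Suc)
  finally show ?case .
qed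

text \<open>Up to the factor \<open>j!\<close>, the coefficients of the derivative are binomial multiples of those of
\<open>g\<close>.\<close>

lemma higher_pderiv_int_poly_divisible:
  fixes g :: "int poly"
  obtains h where "(pderiv ^^ j) g = smult (fact j) h" "degree h \<le> degree g"
proof -
  have "fact j dvd pochhammer (of_nat (Suc n) :: int) j" for n
    using fact_dvd_pochhammer[of j "Suc n"] by simp
  then have "[:fact j:] dvd (pderiv ^^ j) g"
    unfolding const_poly_dvd_iff coeff_higher_pderiv by (intro allI dvd_mult2)
  then obtain h where h: "(pderiv ^^ j) g = smult (fact j) h" by (auto elim!: dvdE)
  have "degree h = degree ((pderiv ^^ j) g)" by (simp add: h)
  also have "\<dots> \<le> degree g" by (simp add: degree_higher_pderiv)
  finally show ?thesis using that h by blast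
qed

lemma power_dvd_higher_pderiv:
  "P ^ (k + j) dvd g \<Longrightarrow> P ^ k dvd (pderiv ^^ j) g"
proof (induction j arbitrary: g)
  case (Suc j)
  then obtain h where "g = P ^ Suc (k + j) * h" by (auto elim: dvdE)
  then have "pderiv g = P ^ Suc (k + j) * pderiv h + h * (smult (of_nat (Suc (k + j))) (P ^ (k + j)) * pderiv P)"
    by (simp only: pderiv_mult pderiv_power_Suc)
  also have "\<dots> = P ^ (k + j) * (P * pderiv h + smult (of_nat (Suc (k + j))) (pderiv P * h))"
    by (simp add: algebra_simps del: of_nat_Suc)
  finally have "P ^ (k + j) dvd pderiv g" by simp
  then have "P ^ k dvd (pderiv ^^ j) (pderiv g)"
    by (intro Suc.IH) simp
  then show ?case by (simp add: funpow_swap1)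
qed simp

lemma common_denominator:
  fixes a :: "nat \<Rightarrow> 'a :: field_char_0"
  assumes "\<And>n. a n \<in> \<rat>"
  obtains E :: int where "E > 0" "\<And>j. j < m \<Longrightarrow> of_int E * a j \<in> \<int>"
proof -
  have "\<exists>E::int. E > 0 \<and> (\<forall>j<m. of_int E * a j \<in> \<int>)"
  proof (induction m)
    case (Suc m)
    then obtain E :: int where E: "E > 0" "\<And>j. j < m \<Longrightarrow> of_int E * a j \<in> \<int>" by blast
    obtain c d :: int where cd: "d > 0" "a m = of_int c / of_int d"
      using assms[of m] by (elim Rats_cases') auto
    have "of_int (E * d) * a j \<in> \<int>" if "j < Suc m" for j
    proof (cases "j = m")
      case True
      have "of_int (E * d) * a j = of_int (E * c)" using cd True by simp
      then show ?thesis by (simp only: Ints_of_int)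
    next
      case False
      then have "of_int d * (of_int E * a j) \<in> \<int>" using that by (intro Ints_mult E) auto
      then show ?thesis by (simp add: mult_ac)
    qed
    then show ?case using E(1) cd(1) by (intro exI[of _ "E * d"]) auto
  qed (auto intro: exI[of _ 1])
  then show ?thesis using that by blast
qed

text \<open>The setting is a function \<open>F(z) = (\<Sum>i\<in>I. \<gamma> i * exp (\<beta> i * z))\<close> with rational Taylor
coefficients (up to factorials) and algebraic exponents that vanishes at 1. The aim is
\<open>F = 0\<close>. The functional \<open>L\<close> encodes \<open>F\<close> by its moments, and \<open>T\<close> is \<open>L\<close> after Hermite's
operator. By the vanishing at 1, \<open>T\<close> of the \<open>n\<close>-th monomial is \<open>- n!\<close> times a
combination of remainders of the exponential series, hence only of exponential size. On multiples of a high
power \<open>p ^ N\<close> of an integer polynomial that kills the exponents, however, \<open>T\<close> is divisible by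
\<open>N!\<close> up to a denominator of exponential size. So \<open>T\<close> is zero there for large \<open>N\<close>, which means that \<open>T\<close>
vanishes on an ideal, and comparing \<open>T\<close> on a polynomial and its derivative shows that this is
possible only for \<open>L = 0\<close>.\<close>

locale vanishing_exp_sum =
  fixes I :: "'i set" and \<beta> \<gamma> :: "'i \<Rightarrow> complex"
  assumes fin: "finite I"
    and algebraic_exponents: "\<And>i. i \<in> I \<Longrightarrow> algebraic (\<beta> i)"
    and rational_moments: "\<And>n. (\<Sum>i\<in>I. \<gamma> i * \<beta> i ^ n) \<in> \<rat>"
    and vanishing: "(\<Sum>i\<in>I. \<gamma> i * exp (\<beta> i)) = 0"
begin

definition L :: "complex poly \<Rightarrow> complex" where
  "L h = (\<Sum>i\<in>I. \<gamma> i * poly h (\<beta> i))"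

definition T :: "complex poly \<Rightarrow> complex" where
  "T h = L (deriv_sum h)"

lemma L_add: "L (p + q) = L p + L q"
  by (simp add: L_def algebra_simps sum.distrib)

lemma L_smult: "L (smult c p) = c * L p"
  by (simp add: L_def sum_distrib_left mult_ac)

lemma L_0 [simp]: "L 0 = 0"
  by (simp add: L_def)

lemma L_sum: "L (sum f A) = (\<Sum>x\<in>A. L (f x))"
  by (induction A rule: infinite_finite_induct) (simp_all add: L_add)

lemma L_monom: "L (monom 1 n) = (\<Sum>i\<in>I. \<gamma> i * \<beta> i ^ n)"
  by (simp add: L_def poly_monom)

lemma T_add: "T (p + q) = T p + T q"
  by (simp add: T_def deriv_sum_add L_add)

lemma T_smult: "T (smult c p) = c * T p"
  by (simp add: T_def deriv_sum_smult L_smult)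

lemma T_0 [simp]: "T 0 = 0"
  using T_smult[of 0 0] by simp

lemma T_sum: "T (sum f A) = (\<Sum>x\<in>A. T (f x))"
  by (induction A rule: infinite_finite_induct) (simp_all add: T_add)

lemma T_unfold: "T p = L p + T (pderiv p)"
  by (simp add: T_def deriv_sum_unfold[of p] L_add)

lemma T_monom_bound:
  obtains K R :: real where "K > 0" "R \<ge> 1" "\<And>n. norm (T (monom 1 n)) \<le> K * R ^ n"
proof -
  define R where "R = 1 + (\<Sum>i\<in>I. norm (\<beta> i))"
  define K where "K = 1 + (\<Sum>i\<in>I. norm (\<gamma> i) * (exp (norm (\<beta> i)) * R))"
  have R1: "R \<ge> 1" unfolding R_def by (simp add: sum_nonneg)
  have R2: "norm (\<beta> i) \<le> R" if "i \<in> I" for i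
    using member_le_sum[OF that, of "\<lambda>i. norm (\<beta> i)"] fin by (simp add: R_def)
  have bound: "norm (T (monom 1 n)) \<le> K * R ^ n" for n
  proof -
    have "T (monom 1 n) = (\<Sum>i\<in>I. \<gamma> i * (fact n * (\<Sum>k\<le>n. \<beta> i ^ k / fact k))) - fact n * (\<Sum>i\<in>I. \<gamma> i * exp (\<beta> i))"
      by (simp add: T_def L_def poly_deriv_sum_monom vanishing)
    also have "\<dots> = (\<Sum>i\<in>I. - (\<gamma> i * fact n * (exp (\<beta> i) - (\<Sum>k\<le>n. \<beta> i ^ k / fact k))))"
      by (simp add: sum_distrib_left algebra_simps sum_subtractf flip: sum_distrib_left)
    also have "norm \<dots> \<le> (\<Sum>i\<in>I. norm (\<gamma> i) * (exp (norm (\<beta> i)) * R) * R ^ n)"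
    proof (rule sum_norm_le)
      fix i assume i: "i \<in> I"
      have "norm (- (\<gamma> i * fact n * (exp (\<beta> i) - (\<Sum>k\<le>n. \<beta> i ^ k / fact k)))) =
          norm (\<gamma> i) * (fact n * norm (exp (\<beta> i) - (\<Sum>k\<le>n. \<beta> i ^ k / fact k)))"
        by (simp add: norm_mult)
      also have "\<dots> \<le> norm (\<gamma> i) * (fact n * (exp (norm (\<beta> i)) * norm (\<beta> i) ^ Suc n / fact n))"
        by (intro mult_left_mono Taylor_exp_field) auto
      also have "\<dots> = norm (\<gamma> i) * (exp (norm (\<beta> i)) * norm (\<beta> i) ^ Suc n)" by simp
      also have "\<dots> \<le> norm (\<gamma> i) * (exp (norm (\<beta> i)) * R ^ Suc n)"
        by (intro mult_left_mono power_mono R2 i) auto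
      finally show "norm (- (\<gamma> i * fact n * (exp (\<beta> i) - (\<Sum>k\<le>n. \<beta> i ^ k / fact k)))) \<le>
          norm (\<gamma> i) * (exp (norm (\<beta> i)) * R) * R ^ n" by (simp add: mult_ac)
    qed
    also have "\<dots> = (K - 1) * R ^ n" by (simp add: K_def sum_distrib_right)
    also have "\<dots> \<le> K * R ^ n" using R1 by (intro mult_right_mono) auto
    finally show ?thesis .
  qed
  have "K > 0" unfolding K_def using R1 by (intro add_pos_nonneg sum_nonneg mult_nonneg_nonneg) auto
  with R1 bound that show ?thesis by blast
qed

lemma exists_killing_int_poly:
  obtains p :: "int poly" where "p \<noteq> 0" "degree p > 0" "\<And>i. i \<in> I \<Longrightarrow> poly (map_poly of_int p) (\<beta> i) = 0"
proof -
  have "\<exists>p :: int poly. p \<noteq> 0 \<and> (\<forall>i\<in>I. poly (map_poly of_int p) (\<beta> i) = 0)"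
    using fin algebraic_exponents
  proof (induction I rule: finite_induct)
    case empty
    show ?case by (rule exI[of _ 1]) simp
  next
    case (insert x F)
    then obtain P :: "int poly" where P: "P \<noteq> 0" "\<forall>i\<in>F. poly (map_poly of_int P) (\<beta> i) = 0" by auto
    obtain p :: "int poly" where p: "p \<noteq> 0" "poly (map_poly of_int p) (\<beta> x) = 0"
      using insert.prems[of x] by (auto elim!: algebraicE')
    have "map_poly of_int (p * P) = map_poly of_int p * (map_poly of_int P :: complex poly)"
      by (intro poly_eqI) (simp add: coeff_map_poly coeff_mult)
    with P p show ?case by (intro exI[of _ "p * P"]) simp
  qed
  then obtain p :: "int poly" where p: "p \<noteq> 0" "\<forall>i\<in>I. poly (map_poly of_int p) (\<beta> i) = 0" by blast
  \<comment> \<open>The extra root 0 makes the degree positive also if \<open>I\<close> is empty.\<close>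
  show ?thesis
    by (rule that[of "pCons 0 p"]) (use p in \<open>auto simp: map_poly_pCons\<close>)
qed

text \<open>The polynomial \<open>p\<close> gives a linear recurrence for the moments with integer coefficients and
leading coefficient \<open>lead_coeff p\<close>. Each step therefore costs one more factor \<open>lead_coeff p\<close> in the
denominator, beyond a common denominator \<open>E\<close> of the initial values.\<close>

lemma integral_moments:
  fixes p :: "int poly"
  assumes p: "\<And>i. i \<in> I \<Longrightarrow> poly (map_poly of_int p) (\<beta> i) = 0" and deg: "degree p > 0"
  obtains E :: int where "E > 0"
    "\<And>q n. degree q \<le> n \<Longrightarrow> of_int (E * lead_coeff p ^ n) * L (map_poly of_int q) \<in> \<int>"
proof -
  define m where "m = degree p"
  define l where "l = lead_coeff p"
  define a where "a n = L (monom 1 n)" for n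
  have "a n \<in> \<rat>" for n unfolding a_def L_monom by (rule rational_moments)
  then obtain E :: int where E: "E > 0" "\<And>j. j < m \<Longrightarrow> of_int E * a j \<in> \<int>"
    using common_denominator[of a m] by blast
  have rec: "of_int l * a (m + n) = - (\<Sum>j<m. of_int (coeff p j) * a (n + j))" for n
  proof -
    have "(\<Sum>j\<le>m. of_int (coeff p j) * a (n + j)) =
        (\<Sum>i\<in>I. \<Sum>j\<le>m. of_int (coeff p j) * (\<gamma> i * \<beta> i ^ (n + j)))"
      unfolding a_def L_monom sum_distrib_left by (rule sum.swap)
    also have "\<dots> = (\<Sum>i\<in>I. \<gamma> i * \<beta> i ^ n * poly (map_poly of_int p) (\<beta> i))"
      by (simp add: poly_altdef coeff_map_poly degree_map_poly m_def sum_distrib_left power_add mult_ac)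
    also have "\<dots> = 0" by (simp add: p)
    finally have "(\<Sum>j\<le>m. of_int (coeff p j) * a (n + j)) = 0" .
    moreover have "{..m} = insert m {..<m}" by auto
    ultimately show ?thesis by (simp add: l_def m_def add.commute eq_neg_iff_add_eq_0)
  qed
  have int_a: "of_int (E * l ^ n) * a n \<in> \<int>" for n
  proof (induction n rule: less_induct)
    case (less n)
    show ?case
    proof (cases "n < m")
      case True
      have "of_int (l ^ n) * (of_int E * a n) \<in> \<int>"
        by (intro Ints_mult Ints_of_int E True)
      then show ?thesis by (simp add: mult_ac)
    next
      case False
      define d where "d = n - m"
      have n: "n = m + d" "n \<noteq> 0" using False deg by (auto simp: d_def m_def)
      have "l ^ n = l * l ^ (n - 1)" using n(2) by (cases n) auto
      moreover have "a n = a (m + d)" by (simp add: n)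
      ultimately have "of_int (E * l ^ n) * a n = of_int (E * l ^ (n - 1)) * (of_int l * a (m + d))"
        by (simp only: of_int_mult mult_ac)
      also have "\<dots> = - (\<Sum>j<m. of_int (coeff p j * l ^ (m - 1 - j)) * (of_int (E * l ^ (d + j)) * a (d + j)))"
      proof -
        have "l ^ (n - 1) = l ^ (m - 1 - j) * l ^ (d + j)" if "j < m" for j
          using that n by (simp flip: power_add)
        then show ?thesis
          unfolding rec mult_minus_right sum_distrib_left
          by (intro arg_cong[of _ _ uminus] sum.cong) (auto simp: mult_ac)
      qed
      also have "\<dots> \<in> \<int>"
        using n by (intro Ints_minus Ints_sum Ints_mult Ints_of_int less.IH) auto
      finally show ?thesis .
    qed
  qed
  have "of_int (E * l ^ n) * L (map_poly of_int q) \<in> \<int>" if "degree q \<le> n" for q n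
  proof -
    have "map_poly of_int q = (\<Sum>j\<le>degree q. smult (of_int (coeff q j)) (monom (1 :: complex) j))"
      by (subst poly_as_sum_of_monoms[symmetric])
         (simp add: smult_monom coeff_map_poly degree_map_poly)
    then have Lq: "L (map_poly of_int q) = (\<Sum>j\<le>degree q. of_int (coeff q j) * a j)"
      by (simp add: L_sum L_smult a_def)
    have "of_int (E * l ^ n) * L (map_poly of_int q) =
        (\<Sum>j\<le>degree q. of_int (coeff q j * l ^ (n - j)) * (of_int (E * l ^ j) * a j))"
      unfolding Lq sum_distrib_left
    proof (rule sum.cong)
      fix j assume "j \<in> {..degree q}"
      then have "l ^ n = l ^ (n - j) * l ^ j" using that by (simp flip: power_add)
      then show "of_int (E * l ^ n) * (of_int (coeff q j) * a j) =
          of_int (coeff q j * l ^ (n - j)) * (of_int (E * l ^ j) * a j)"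
        by (simp only: of_int_mult mult_ac)
    qed auto
    also have "\<dots> \<in> \<int>" by (intro Ints_sum Ints_mult Ints_of_int int_a)
    finally show ?thesis .
  qed
  with E(1) that show ?thesis unfolding l_def by blast
qed

text \<open>Derivatives of order below \<open>N\<close> of a multiple of \<open>p ^ N\<close> still vanish at the exponents, and those of
order at least \<open>N\<close> carry a factor \<open>N!\<close>.\<close>

lemma factorial_divisibility:
  fixes p :: "int poly"
  assumes p: "\<And>i. i \<in> I \<Longrightarrow> poly (map_poly of_int p) (\<beta> i) = 0"
    and E: "\<And>q n. degree q \<le> n \<Longrightarrow> of_int (E * l ^ n) * L (map_poly of_int q) \<in> \<int>"
    and g: "p ^ N dvd g" and deg: "degree g \<le> n"
  shows "of_int (E * l ^ n) * T (map_poly of_int g) / fact N \<in> \<int>"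
proof -
  have hom: "map_poly of_int (x * y) = map_poly of_int x * (map_poly of_int y :: complex poly)"
    "map_poly of_int (pderiv x) = pderiv (map_poly of_int x :: complex poly)"
    "map_poly of_int (smult c x) = smult (of_int c) (map_poly of_int x :: complex poly)" for x y c
    by (intro poly_eqI; simp add: coeff_map_poly coeff_mult coeff_pderiv)+
  have hom_higher: "map_poly of_int ((pderiv ^^ j) x) = (pderiv ^^ j) (map_poly of_int x :: complex poly)" for x j
    by (induction j) (simp_all add: hom(2))
  have summand: "of_int (E * l ^ n) * L ((pderiv ^^ j) (map_poly of_int g)) / fact N \<in> \<int>" for j
  proof (cases "j < N")
    case True
    then have "p dvd p ^ (N - j)" by (intro dvd_power) auto
    also have "p ^ (N - j) dvd (pderiv ^^ j) g"
      using g True by (intro power_dvd_higher_pderiv) simp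
    finally obtain h where "(pderiv ^^ j) g = p * h" by (rule dvdE)
    then have "(pderiv ^^ j) (map_poly of_int g) = map_poly of_int p * (map_poly of_int h :: complex poly)"
      by (simp flip: hom_higher add: hom)
    then have "L ((pderiv ^^ j) (map_poly of_int g)) = 0"
      by (simp add: L_def p)
    then show ?thesis by simp
  next
    case False
    obtain h where h: "(pderiv ^^ j) g = smult (fact j) h" "degree h \<le> degree g"
      by (rule higher_pderiv_int_poly_divisible)
    obtain c :: int where c: "fact j = fact N * c"
      using fact_dvd[of N j] False by (auto elim!: dvdE)
    have "(pderiv ^^ j) (map_poly of_int g) = smult (of_int (fact j)) (map_poly of_int h :: complex poly)"
      by (simp only: hom_higher[symmetric] h hom)
    moreover have "of_int (fact j) = (fact N * of_int c :: complex)"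
      by (simp only: c of_int_mult of_int_fact)
    ultimately have "of_int (E * l ^ n) * L ((pderiv ^^ j) (map_poly of_int g)) / fact N =
        of_int c * (of_int (E * l ^ n) * L (map_poly of_int h))"
      by (simp add: L_smult del: of_int_fact)
    also have "\<dots> \<in> \<int>"
      using h(2) deg by (intro Ints_mult Ints_of_int E) auto
    finally show ?thesis .
  qed
  have "of_int (E * l ^ n) * T (map_poly of_int g) / fact N =
      (\<Sum>j\<le>degree g. of_int (E * l ^ n) * L ((pderiv ^^ j) (map_poly of_int g)) / fact N)"
    by (simp add: T_def deriv_sum_def L_sum sum_distrib_left sum_divide_distrib degree_map_poly)
  also have "\<dots> \<in> \<int>" by (intro Ints_sum summand)
  finally show ?thesis .
qed

text \<open>For a fixed range of shifts \<open>s < degree p\<close> the number \<open>w N s\<close> is zero once \<open>N!\<close> outgrows the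
exponential bounds. All these \<open>N\<close> together propagate the zeros: the recurrence
expresses \<open>w (N + 1) s\<close> by \<open>w N s, ..., w N (s + degree p)\<close> and can be solved for the last term.\<close>

lemma T_kills_ideal:
  obtains q where "q \<noteq> 0" "\<And>h. T (q * h) = 0"
proof -
  obtain p where p: "p \<noteq> 0" "degree p > 0" "\<And>i. i \<in> I \<Longrightarrow> poly (map_poly of_int p) (\<beta> i) = 0"
    using exists_killing_int_poly by metis
  obtain E :: int where E: "E > 0"
    "\<And>q n. degree q \<le> n \<Longrightarrow> of_int (E * lead_coeff p ^ n) * L (map_poly of_int q) \<in> \<int>"
    using integral_moments[OF p(3,2)] by metis
  obtain K R :: real where KR: "K > 0" "R \<ge> 1" "\<And>n. norm (T (monom 1 n)) \<le> K * R ^ n"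
    using T_monom_bound by metis
  define P :: "complex poly" where "P = map_poly of_int p"
  define m where "m = degree p"
  define l where "l = lead_coeff p"
  define w where "w N s = T (P ^ N * monom 1 s)" for N s
  have l0: "l \<noteq> 0" using p(1) by (simp add: l_def)
  have hom: "map_poly of_int (x * y) = map_poly of_int x * (map_poly of_int y :: complex poly)" for x y
    by (intro poly_eqI) (simp add: coeff_map_poly coeff_mult)
  have hom_power: "map_poly of_int (x ^ n) = (map_poly of_int x ^ n :: complex poly)" for x n
    by (induction n) (simp_all add: hom)
  have w_rec: "w (Suc N) s = (\<Sum>j\<le>m. of_int (coeff p j) * w N (s + j))" for N s
  proof -
    have "P = (\<Sum>j\<le>m. smult (of_int (coeff p j)) (monom 1 j))"
      unfolding P_def m_def by (subst poly_as_sum_of_monoms[symmetric])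
         (simp add: smult_monom coeff_map_poly degree_map_poly)
    then have "P ^ Suc N * monom 1 s =
        (\<Sum>j\<le>m. smult (of_int (coeff p j)) (monom 1 j)) * (P ^ N * monom 1 s)"
      by (simp add: mult.assoc)
    also have "\<dots> = (\<Sum>j\<le>m. smult (of_int (coeff p j)) (P ^ N * (monom 1 s * monom 1 j)))"
      unfolding sum_distrib_right by (intro sum.cong) (simp_all add: mult_ac)
    also have "\<dots> = (\<Sum>j\<le>m. smult (of_int (coeff p j)) (P ^ N * monom 1 (s + j)))"
      by (simp add: mult_monom)
    finally show ?thesis by (simp add: w_def T_sum T_smult)
  qed
  define M where "M = (\<Sum>j\<le>m. \<bar>of_int (coeff p j)\<bar> * R ^ j :: real)"
  have M0: "M \<ge> 0" unfolding M_def using KR(2) by (intro sum_nonneg) auto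
  have w_bound: "norm (w N s) \<le> K * M ^ N * R ^ s" for N s
  proof (induction N arbitrary: s)
    case 0
    show ?case using KR(3) by (simp add: w_def)
  next
    case (Suc N)
    have "norm (w (Suc N) s) \<le> (\<Sum>j\<le>m. \<bar>of_int (coeff p j)\<bar> * (K * M ^ N * R ^ (s + j)))"
      unfolding w_rec by (intro sum_norm_le) (auto simp: norm_mult intro!: mult_left_mono Suc.IH)
    also have "\<dots> = K * M ^ Suc N * R ^ s"
      by (simp add: M_def sum_distrib_left sum_distrib_right power_add mult_ac)
    finally show ?case .
  qed
  have w_int: "of_int (E * l ^ (N * m + s)) * w N s / fact N \<in> \<int>" for N s
  proof -
    have "map_poly of_int (p ^ N * monom 1 s) = P ^ N * monom 1 s"
      by (simp add: hom hom_power P_def map_poly_monom)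
    moreover have "degree (p ^ N * monom 1 s) \<le> N * m + s"
      using p(1) by (simp add: degree_mult_eq degree_power_eq degree_monom_eq m_def)
    ultimately show ?thesis
      using factorial_divisibility[OF p(3) E(2), of N "p ^ N * monom 1 s" "N * m + s"]
      by (simp add: w_def l_def)
  qed
  define C where "C = of_int E * K * (\<bar>of_int l\<bar> * R) ^ m"
  define X where "X = \<bar>of_int l\<bar> ^ m * M"
  have small: "w N s = 0" if "C * X ^ N / fact N < 1" "s < m" for N s
  proof -
    have l1: "\<bar>of_int l\<bar> \<ge> (1 :: real)" using l0 by linarith
    have lR: "\<bar>of_int l\<bar> * R \<ge> 1" using mult_mono[OF l1 KR(2)] KR(2) l1 by simp
    obtain z :: int where z: "of_int (E * l ^ (N * m + s)) * w N s / fact N = of_int z"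
      using w_int[of N s] by (auto elim: Ints_cases)
    have "\<bar>of_int z\<bar> = norm (of_int (E * l ^ (N * m + s)) * w N s / fact N)"
      unfolding z by simp
    also have "\<dots> = of_int E * \<bar>of_int l\<bar> ^ (N * m + s) * norm (w N s) / fact N"
      using E(1) by (simp add: norm_mult norm_divide norm_power)
    also have "\<dots> \<le> of_int E * \<bar>of_int l\<bar> ^ (N * m + s) * (K * M ^ N * R ^ s) / fact N"
      using E(1) by (intro divide_right_mono mult_left_mono w_bound) auto
    also have "\<dots> = of_int E * K * X ^ N * (\<bar>of_int l\<bar> * R) ^ s / fact N"
      by (simp add: X_def power_add power_mult_distrib mult_ac flip: power_mult)
    also have "\<dots> \<le> of_int E * K * X ^ N * (\<bar>of_int l\<bar> * R) ^ m / fact N"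
      using E(1) KR(1) lR M0 that(2)
      by (intro divide_right_mono mult_left_mono power_increasing)
         (auto simp: X_def)
    also have "\<dots> = C * X ^ N / fact N" by (simp add: C_def)
    \<comment> \<open>An integer of absolute value less than 1 is zero.\<close>
    finally have "\<bar>z\<bar> < 1" using that(1) by linarith
    then have "of_int (E * l ^ (N * m + s)) * w N s / fact N = 0" using z by simp
    then show ?thesis using l0 E(1) by simp
  qed
  have "(\<lambda>N. C * X ^ N / fact N) \<longlonglongrightarrow> 0"
    using tendsto_mult_right_zero[OF summable_LIMSEQ_zero[OF summable_exp[of X]], of C]
    by (simp add: field_simps)
  then have "eventually (\<lambda>N. C * X ^ N / fact N < 1) sequentially"
    by (rule order_tendstoD) simp
  then obtain N0 where N0: "\<And>N. N \<ge> N0 \<Longrightarrow> C * X ^ N / fact N < 1"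
    by (auto simp: eventually_sequentially)
  have w0: "w N s = 0" if "N \<ge> N0" for N s
    using that
  proof (induction s arbitrary: N rule: less_induct)
    case (less s)
    show ?case
    proof (cases "s < m")
      case True
      then show ?thesis using small N0 less.prems by blast
    next
      case False
      have "w (Suc N) (s - m) = 0"
        using less.IH[of "s - m" "Suc N"] less.prems p(2) False by (simp add: m_def)
      moreover have "{..m} = insert m {..<m}" by auto
      moreover have "w N (s - m + j) = 0" if "j < m" for j
        using less.IH[of "s - m + j" N] less.prems that False by simp
      ultimately show ?thesis
        using w_rec[of N "s - m"] p(1) False by (simp add: m_def)
    qed
  qed
  have "T (P ^ N0 * h) = 0" for h
  proof -
    have "P ^ N0 * h = (\<Sum>j\<le>degree h. smult (coeff h j) (P ^ N0 * monom 1 j))"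
      by (subst poly_as_sum_of_monoms[symmetric, of h])
         (simp add: sum_distrib_left smult_monom flip: mult_smult_right)
    then show ?thesis using w0[of N0] by (simp add: T_sum T_smult w_def)
  qed
  moreover have "P ^ N0 \<noteq> 0" using p(1) by (simp add: P_def map_poly_eq_0_iff)
  ultimately show ?thesis using that by blast
qed

text \<open>Let \<open>q\<close> generate the ideal of polynomials all of whose multiples are killed by \<open>T\<close>, and suppose it
has a root \<open>\<rho>\<close>. Let \<open>p1\<close> have as its simple roots the exponents other than \<open>\<rho>\<close>. Then \<open>L\<close> kills
the multiples of \<open>q * p1\<close>, and \<open>T (f') = T f - L f\<close> for \<open>f = q * p1 * h\<close> shows that \<open>q' * p1\<close> lies in
the ideal too. This is impossible, as its order at \<open>\<rho>\<close> is smaller than that of \<open>q\<close>. So \<open>q\<close>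
is constant, \<open>T\<close> is zero and so is \<open>L\<close>.\<close>

lemma L_eq_0: "L h = 0"
proof -
  define Q where "Q q \<longleftrightarrow> q \<noteq> 0 \<and> (\<forall>h. T (q * h) = 0)" for q
  obtain q0 where "Q q0" using T_kills_ideal unfolding Q_def by metis
  define q where "q = arg_min degree Q"
  have q: "Q q" and minimal: "\<And>r. Q r \<Longrightarrow> degree q \<le> degree r"
    unfolding q_def using \<open>Q q0\<close> by (auto intro: arg_min_natI arg_min_nat_le)
  have q0: "q \<noteq> 0" and Tq: "\<And>h. T (q * h) = 0" using q by (auto simp: Q_def)
  have "degree q = 0"
  proof (rule ccontr)
    assume "degree q \<noteq> 0"
    then obtain \<rho> where \<rho>: "poly q \<rho> = 0"
      using fundamental_theorem_of_algebra[of q] by (auto simp: constant_degree)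
    define p1 where "p1 = (\<Prod>x\<in>\<beta> ` I - {\<rho>}. [:-x, 1:])"
    have roots: "poly (q * p1) (\<beta> i) = 0" if "i \<in> I" for i
      using fin that \<rho> by (auto simp: p1_def poly_prod)
    have p1: "p1 \<noteq> 0" "poly p1 \<rho> \<noteq> 0" using fin by (auto simp: p1_def poly_prod)
    have kill: "T (pderiv q * p1 * h) = 0" for h
    proof -
      have "L (q * p1 * h) = 0"
        unfolding L_def using roots by (intro sum.neutral) auto
      moreover have "T (q * p1 * h) = 0" using Tq[of "p1 * h"] by (simp add: mult_ac)
      ultimately have "T (pderiv (q * (p1 * h))) = 0"
        using T_unfold[of "q * p1 * h"] by (simp add: mult_ac)
      moreover have "pderiv (q * (p1 * h)) = pderiv q * p1 * h + q * pderiv (p1 * h)"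
        by (subst pderiv_mult) (simp add: mult_ac)
      ultimately show ?thesis
        using Tq[of "pderiv (p1 * h)"] by (simp add: T_add)
    qed
    define r where "r = (pderiv q * p1) mod q"
    have "T (r * h) = 0" for h
    proof -
      have "r * h = pderiv q * p1 * h + q * smult (-1) (((pderiv q * p1) div q) * h)"
        unfolding r_def by (simp add: minus_div_mult_eq_mod[symmetric] algebra_simps)
      then show ?thesis using kill[of h] Tq by (simp only: T_add add_0)
    qed
    then have "Q r" if "r \<noteq> 0" using that by (simp add: Q_def)
    then have "r = 0"
      using minimal[of r] degree_mod_less'[of q "pderiv q * p1"] q0 by (fastforce simp: r_def)
    then have "q dvd pderiv q * p1" by (simp add: r_def dvd_eq_mod_eq_0)
    moreover have "pderiv q \<noteq> 0" using \<open>degree q \<noteq> 0\<close> by (simp add: pderiv_eq_0_iff)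
    ultimately have "order \<rho> q \<le> order \<rho> (pderiv q * p1)"
      using p1 by (intro dvd_imp_order_le) auto
    also have "\<dots> = order \<rho> (pderiv q)"
      using p1 \<open>pderiv q \<noteq> 0\<close> by (simp add: order_mult order_0I)
    finally show False using order_pderiv[OF q0 \<rho>] by simp
  qed
  then obtain c where c: "q = [:c:]" "c \<noteq> 0" using q0 by (auto elim: degree_eq_zeroE)
  have "T h = 0" for h
    using Tq[of "smult (inverse c) h"] c by simp
  then show ?thesis using T_unfold[of h] by simp
qed

end

lemma vanishing_exp_sum_moments:
  fixes \<beta> \<gamma> :: "'i \<Rightarrow> complex"
  assumes "finite I" "\<And>i. i \<in> I \<Longrightarrow> algebraic (\<beta> i)"
    and "\<And>n. (\<Sum>i\<in>I. \<gamma> i * \<beta> i ^ n) \<in> \<rat>" and "(\<Sum>i\<in>I. \<gamma> i * exp (\<beta> i)) = 0"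
  shows "(\<Sum>i\<in>I. \<gamma> i * \<beta> i ^ n) = 0"
proof -
  interpret vanishing_exp_sum I \<beta> \<gamma> by standard (use assms in auto)
  show ?thesis using L_eq_0[of "monom 1 n"] by (simp add: L_monom)
qed

section \<open>The Lindemann-Weierstrass theorem\<close>

lemma algebraic_sum_complex:
  fixes f :: "'i \<Rightarrow> complex"
  assumes "\<And>i. i \<in> I \<Longrightarrow> algebraic (f i)"
  shows "algebraic (\<Sum>i\<in>I. f i)"
  using assms by (induction I rule: infinite_finite_induct) (auto intro: algebraic_add_mult_complex)

text \<open>The coefficients of the series are the values at monomials of the functional
\<open>h \<mapsto> (\<Sum>x\<in>X. k x * h (s x))\<close>, which can be tested on the polynomial that vanishes at
all \<open>s x\<close> except \<open>s x0\<close>.\<close>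

lemma fps_exp_sum_eq_0D:
  fixes k s :: "'i \<Rightarrow> 'a :: field_char_0"
  assumes fin: "finite X" and inj: "inj_on s X"
    and zero: "(\<Sum>x\<in>X. fps_const (k x) * fps_exp (s x)) = 0" and x0: "x0 \<in> X"
  shows "k x0 = 0"
proof -
  have moments: "(\<Sum>x\<in>X. k x * s x ^ n) = 0" for n
  proof -
    have "(\<Sum>x\<in>X. k x * s x ^ n) / fact n = fps_nth (\<Sum>x\<in>X. fps_const (k x) * fps_exp (s x)) n"
      by (simp add: fps_sum_nth sum_divide_distrib)
    then show ?thesis by (simp add: zero)
  qed
  have poly_zero: "(\<Sum>x\<in>X. k x * poly h (s x)) = 0" for h
  proof -
    have "(\<Sum>x\<in>X. k x * poly h (s x)) = (\<Sum>x\<in>X. \<Sum>j\<le>degree h. coeff h j * (k x * s x ^ j))"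
      by (simp add: poly_altdef sum_distrib_left mult_ac)
    also have "\<dots> = (\<Sum>j\<le>degree h. coeff h j * (\<Sum>x\<in>X. k x * s x ^ j))"
      by (subst sum.swap) (simp add: sum_distrib_left)
    finally show ?thesis by (simp add: moments)
  qed
  define h where "h = (\<Prod>y\<in>X - {x0}. [:-s y, 1:])"
  have "(\<Sum>x\<in>X - {x0}. k x * poly h (s x)) = 0"
    using fin by (intro sum.neutral) (auto simp: h_def poly_prod)
  then have "k x0 * poly h (s x0) = 0"
    using poly_zero[of h] sum.remove[OF fin x0, of "\<lambda>x. k x * poly h (s x)"] by simp
  moreover have "poly h (s x0) \<noteq> 0"
    using fin inj x0 by (auto simp: h_def poly_prod inj_on_def)
  ultimately show ?thesis by simp
qed

text \<open>Let \<open>\<sigma>\<close> run over all permutations of a suitable finite set \<open>R\<close> of conjugates and let \<open>F \<sigma>\<close> be the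
exponential sum with \<open>\<sigma>\<close> applied to its coefficients and exponents. Each \<open>F \<sigma>\<close> is a nonzero power
series, because \<open>\<sigma>\<close> keeps coefficients nonzero and exponents distinct, whether or not it
is induced by a field automorphism. So the product of all \<open>F \<sigma>\<close> is nonzero. It has
rational coefficients, is again a sum of exponentials with algebraic exponents, and vanishes at 1
because \<open>F id\<close> does, contradicting the previous section.\<close>

theorem Lindemann_Weierstrass:
  fixes X :: "complex set"
  assumes fin: "finite X" and X: "\<And>x. x \<in> X \<Longrightarrow> algebraic x"
    and c: "\<And>x. x \<in> X \<Longrightarrow> algebraic (c x)"
    and zero: "(\<Sum>x\<in>X. c x * exp x) = 0" and x0: "x0 \<in> X"
  shows "c x0 = 0"
proof (rule ccontr)
  assume c0: "c x0 \<noteq> 0"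
  define Y where "Y = {x \<in> X. c x \<noteq> 0}"
  have Y: "finite Y" "x0 \<in> Y" "Y \<subseteq> X" and cY: "\<And>x. x \<in> Y \<Longrightarrow> c x \<noteq> 0"
    using fin x0 c0 by (auto simp: Y_def)
  have zero_Y: "(\<Sum>x\<in>Y. c x * exp x) = 0"
    using zero fin by (subst sum.mono_neutral_left[of X Y]) (auto simp: Y_def)
  have "finite (Y \<union> c ` Y)" "\<And>z. z \<in> Y \<union> c ` Y \<Longrightarrow> algebraic z"
    using Y X c by auto
  then obtain R where R: "finite R" "0 \<notin> R" "Y \<union> c ` Y - {0} \<subseteq> R" "\<forall>z\<in>R. algebraic z"
    and power: "\<forall>n. (\<Sum>\<rho>\<in>R. \<rho> ^ n) \<in> \<rat>"
    by (rule algebraic_closed_root_set)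
  note power = power[rule_format]
  define S where "S = {\<sigma>. \<sigma> permutes R}"
  have S: "finite S" "id \<in> S" using R(1) by (auto simp: S_def finite_permutations permutes_id)
  \<comment> \<open>The exponent 0 may occur but is not in \<open>R\<close>; it is its own only conjugate.\<close>
  define s where "s \<sigma> x = (if x = 0 then 0 else \<sigma> x)" for \<sigma> :: "complex \<Rightarrow> complex" and x
  have cR: "c x \<in> R" if "x \<in> Y" for x using that R(3) cY by blast
  have sR: "x \<noteq> 0 \<Longrightarrow> x \<in> R" if "x \<in> Y" for x using that R(3) by blast
  have \<sigma>R: "\<sigma> x \<in> R" if "\<sigma> \<in> S" "x \<in> R" for \<sigma> x
    using that by (simp add: S_def permutes_in_image)
  define F where "F \<sigma> = (\<Sum>x\<in>Y. fps_const (\<sigma> (c x)) * fps_exp (s \<sigma> x))" for \<sigma>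
  define \<gamma> where "\<gamma> g = (\<Prod>\<sigma>\<in>S. \<sigma> (c (g \<sigma>)))" for g
  define \<delta> where "\<delta> g = (\<Sum>\<sigma>\<in>S. s \<sigma> (g \<sigma>))" for g
  \<comment> \<open>Multiplying out the product over \<open>S\<close> means choosing a term of every factor.\<close>
  define G where "G = (S \<rightarrow>\<^sub>E Y)"
  have finG: "finite G" unfolding G_def using S Y by (intro finite_PiE) auto

  have perm_poly_s: "perm_poly R (\<lambda>\<sigma>. s \<sigma> x)" if "x \<in> Y" for x
    using that R(1) by (cases "x = 0") (auto simp: s_def intro: perm_poly_const perm_poly_apply sR)
  have fact_Rats: "fact n \<in> (\<rat> :: complex set)" for n
    using Rats_of_nat[of "fact n", where ?'a = complex] by (simp only: of_nat_fact)
  have "perm_poly R (\<lambda>\<sigma>. fps_nth (F \<sigma>) n)" for n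
  proof -
    have const: "perm_poly R (\<lambda>\<sigma>. 1 / fact n)"
      by (intro perm_poly_const Rats_divide Rats_1 fact_Rats)
    have "perm_poly R (\<lambda>\<sigma>. \<Sum>x\<in>Y. \<sigma> (c x) * (s \<sigma> x ^ n * (1 / fact n)))"
    proof (rule perm_poly_sum)
      fix x assume x: "x \<in> Y"
      show "perm_poly R (\<lambda>\<sigma>. \<sigma> (c x) * (s \<sigma> x ^ n * (1 / fact n)))"
        by (rule perm_poly_mult[OF perm_poly_apply[OF R(1) cR[OF x]]
              perm_poly_mult[OF perm_poly_power[OF perm_poly_s[OF x]] const]])
    qed
    then show ?thesis by (simp add: F_def fps_sum_nth)
  qed
  then have rational: "fps_nth (\<Prod>\<sigma>\<in>S. F \<sigma>) n \<in> \<rat>" for n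
    unfolding S_def using R(1) power by (rule prod_conjugate_fps_rational)

  have F_nz: "F \<sigma> \<noteq> 0" if "\<sigma> \<in> S" for \<sigma>
  proof
    assume "F \<sigma> = 0"
    have "inj_on (s \<sigma>) Y"
    proof (rule inj_onI)
      fix x y assume "x \<in> Y" "y \<in> Y" "s \<sigma> x = s \<sigma> y"
      moreover have "\<sigma> z \<noteq> 0" if "z \<in> Y" "z \<noteq> 0" for z
        using \<sigma>R[OF \<open>\<sigma> \<in> S\<close> sR[OF that]] R(2) by auto
      moreover have "\<sigma> x = \<sigma> y \<Longrightarrow> x = y"
        using that by (simp add: S_def permutes_def) metis
      ultimately show "x = y" by (auto simp: s_def split: if_splits)
    qed
    from fps_exp_sum_eq_0D[OF Y(1) this \<open>F \<sigma> = 0\<close>[unfolded F_def] Y(2)]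
    show False using \<sigma>R[OF that cR[OF Y(2)]] R(2) by simp
  qed

  have "(\<Prod>\<sigma>\<in>S. F \<sigma>) = (\<Sum>g\<in>G. \<Prod>\<sigma>\<in>S. fps_const (\<sigma> (c (g \<sigma>))) * fps_exp (s \<sigma> (g \<sigma>)))"
    unfolding F_def G_def using S(1) Y(1) by (intro prod_sum_PiE) auto
  also have "\<dots> = (\<Sum>g\<in>G. fps_const (\<gamma> g) * fps_exp (\<delta> g))"
  proof (rule sum.cong)
    fix g
    have "(\<Prod>\<sigma>\<in>A. fps_const (\<sigma> (c (g \<sigma>))) * fps_exp (s \<sigma> (g \<sigma>))) =
        fps_const (\<Prod>\<sigma>\<in>A. \<sigma> (c (g \<sigma>))) * fps_exp (\<Sum>\<sigma>\<in>A. s \<sigma> (g \<sigma>))" if "finite A" for A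
      using that by (induction A rule: finite_induct)
        (simp_all add: fps_exp_add_mult mult_ac flip: fps_const_mult)
    then show "(\<Prod>\<sigma>\<in>S. fps_const (\<sigma> (c (g \<sigma>))) * fps_exp (s \<sigma> (g \<sigma>))) = fps_const (\<gamma> g) * fps_exp (\<delta> g)"
      using S(1) by (simp add: \<gamma>_def \<delta>_def)
  qed auto
  finally have F_expand: "(\<Prod>\<sigma>\<in>S. F \<sigma>) = (\<Sum>g\<in>G. fps_const (\<gamma> g) * fps_exp (\<delta> g))" .
  then have F_nth: "fps_nth (\<Prod>\<sigma>\<in>S. F \<sigma>) n = (\<Sum>g\<in>G. \<gamma> g * \<delta> g ^ n) / fact n" for n
    by (simp add: fps_sum_nth sum_divide_distrib)

  have moments_rational: "(\<Sum>g\<in>G. \<gamma> g * \<delta> g ^ n) \<in> \<rat>" for n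
  proof -
    have "fact n * fps_nth (\<Prod>\<sigma>\<in>S. F \<sigma>) n \<in> \<rat>"
      by (intro Rats_mult fact_Rats rational)
    then show ?thesis by (simp add: F_nth)
  qed
  have algebraic_\<delta>: "algebraic (\<delta> g)" if "g \<in> G" for g
    unfolding \<delta>_def
  proof (rule algebraic_sum_complex)
    fix \<sigma> assume \<sigma>: "\<sigma> \<in> S"
    then have "g \<sigma> \<in> Y" using that by (auto simp: G_def)
    then show "algebraic (s \<sigma> (g \<sigma>))" using R(4) \<sigma>R[OF \<sigma> sR] by (auto simp: s_def)
  qed
  have "(\<Sum>g\<in>G. \<gamma> g * exp (\<delta> g)) = (\<Sum>g\<in>G. \<Prod>\<sigma>\<in>S. \<sigma> (c (g \<sigma>)) * exp (s \<sigma> (g \<sigma>)))"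
    using S(1) by (simp add: \<gamma>_def \<delta>_def exp_sum prod.distrib)
  also have "\<dots> = (\<Prod>\<sigma>\<in>S. \<Sum>x\<in>Y. \<sigma> (c x) * exp (s \<sigma> x))"
    unfolding G_def using S(1) Y(1) by (intro prod_sum_PiE[symmetric]) auto
  also have "\<dots> = 0"
  proof (rule prod_zero)
    have "s id = id" by (auto simp: s_def)
    then show "\<exists>\<sigma>\<in>S. (\<Sum>x\<in>Y. \<sigma> (c x) * exp (s \<sigma> x)) = 0"
      using S(2) zero_Y by (intro bexI[of _ id]) auto
  qed (rule S(1))
  finally have "(\<Sum>g\<in>G. \<gamma> g * \<delta> g ^ n) = 0" for n
    by (intro vanishing_exp_sum_moments finG algebraic_\<delta> moments_rational)
  then have "(\<Prod>\<sigma>\<in>S. F \<sigma>) = 0" by (intro fps_ext) (simp add: F_nth)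
  then show False using F_nz S(1) by simp
qed

text \<open>After collecting equal exponents all coefficients vanish, so nothing in the relation depends on the
exponential function. This form spares case distinctions on which exponents coincide.\<close>

lemma Lindemann_Weierstrass_substitute:
  fixes \<beta> c :: "'i \<Rightarrow> complex"
  assumes fin: "finite I" and "\<And>i. i \<in> I \<Longrightarrow> algebraic (\<beta> i)" "\<And>i. i \<in> I \<Longrightarrow> algebraic (c i)"
    and zero: "(\<Sum>i\<in>I. c i * exp (\<beta> i)) = 0"
  shows "(\<Sum>i\<in>I. c i * g (\<beta> i)) = 0"
proof -
  define C where "C x = (\<Sum>i | i \<in> I \<and> \<beta> i = x. c i)" for x
  have group: "(\<Sum>i\<in>I. c i * h (\<beta> i)) = (\<Sum>x\<in>\<beta> ` I. C x * h x)" for h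
  proof -
    have "(\<Sum>i\<in>I. c i * h (\<beta> i)) = (\<Sum>x\<in>\<beta> ` I. \<Sum>i | i \<in> I \<and> \<beta> i = x. c i * h (\<beta> i))"
      using fin by (rule sum.image_gen)
    then show ?thesis by (simp add: C_def sum_distrib_right)
  qed
  have "C x = 0" if "x \<in> \<beta> ` I" for x
  proof (rule Lindemann_Weierstrass[OF _ _ _ _ that])
    show "algebraic (C x)" for x
      unfolding C_def by (intro algebraic_sum_complex) (use assms in auto)
    show "(\<Sum>x\<in>\<beta> ` I. C x * exp x) = 0" using zero group[of exp] by simp
  qed (use assms in auto)
  then show ?thesis unfolding group by simp
qed

text \<open>The version for hyperbolic cosines. Taking for \<open>g\<close> the indicator function of \<open>{r, -r}\<close> extracts the
total coefficient of \<open>cosh r\<close>.\<close>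

lemma cosh_relation_substitute:
  fixes xs :: "(real \<times> real) list"
  assumes alg: "\<And>k s. (k, s) \<in> set xs \<Longrightarrow> algebraic k \<and> algebraic s"
    and zero: "(\<Sum>(k, s)\<leftarrow>xs. k * cosh s) = 0" and even: "\<And>x. g (- x) = g x"
  shows "(\<Sum>(k, s)\<leftarrow>xs. k * g s) = 0"
proof -
  define I where "I = {..<length xs} \<times> {1, -1 :: real}"
  define k where "k i = fst (xs ! i)" for i
  define s where "s i = snd (xs ! i)" for i
  have eq: "(\<Sum>(k, s)\<leftarrow>xs. k * h s) = (\<Sum>i<length xs. k i * h (s i))" for h :: "real \<Rightarrow> real"
    by (simp add: sum_list_sum_nth k_def s_def case_prod_unfold atLeast0LessThan)
  have I: "(\<Sum>(i, e)\<in>I. f i e) = (\<Sum>i<length xs. f i 1 + f i (- 1))" for f :: "nat \<Rightarrow> real \<Rightarrow> complex"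
    unfolding I_def by (subst sum.cartesian_product[symmetric]) simp
  have alg': "algebraic (k i) \<and> algebraic (s i)" if "i < length xs" for i
    using alg[of "k i" "s i"] that by (simp add: k_def s_def)
  have "(\<Sum>(i, e)\<in>I. of_real (k i) * exp (of_real (e * s i))) =
      complex_of_real (2 * (\<Sum>i<length xs. k i * cosh (s i)))"
    unfolding I by (simp add: cosh_def sum_distrib_left algebra_simps flip: exp_of_real)
  also have "\<dots> = 0" using zero eq[of cosh] by simp
  finally have "(\<Sum>p\<in>I. (\<lambda>(i, e). of_real (k i)) p * exp ((\<lambda>(i, e). complex_of_real (e * s i)) p)) = 0"
    by (simp add: case_prod_unfold)
  then have "(\<Sum>p\<in>I. (\<lambda>(i, e). of_real (k i)) p *
      (\<lambda>z. of_real (g (Re z))) ((\<lambda>(i, e). complex_of_real (e * s i)) p)) = (0 :: complex)"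
    by (rule Lindemann_Weierstrass_substitute[rotated -1]) (use alg' in \<open>auto simp: I_def\<close>)
  then have "(\<Sum>(i, e)\<in>I. of_real (k i) * complex_of_real (g (e * s i))) = 0"
    by (simp add: case_prod_unfold)
  then have "complex_of_real (2 * (\<Sum>i<length xs. k i * g (s i))) = 0"
    unfolding I by (simp add: even sum_distrib_left mult_ac)
  then show ?thesis unfolding eq of_real_eq_0_iff by simp
qed

section \<open>Real algebraic numbers\<close>

lemma algebraic_add_mult_real:
  fixes x y :: real
  assumes "algebraic x" "algebraic y"
  shows "algebraic (x + y)" "algebraic (x * y)"
  using algebraic_add_mult_complex[of "of_real x" "of_real y"] assms
  by (simp_all flip: of_real_add of_real_mult)

lemma algebraic_diff_real: "algebraic x \<Longrightarrow> algebraic y \<Longrightarrow> algebraic (x - y :: real)"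
  using algebraic_add_mult_real(1)[of x "- y"] by simp

lemma algebraic_root_of_unity:
  fixes w :: "'a :: field_char_0"
  assumes "w ^ n = 1" "n > 0"
  shows "algebraic w"
  by (rule algebraic_root[of 1 "monom 1 n"]) (use assms in \<open>auto simp: poly_monom degree_monom_eq\<close>)

lemma algebraic_cos_rational_multiple_pi:
  assumes "\<theta> \<in> rational_multiples_of_pi"
  shows "algebraic (cos \<theta>)"
proof -
  obtain q where q: "q \<in> \<rat>" "\<theta> = q * pi" using assms by (auto simp: rational_multiples_of_pi_def)
  obtain m n :: int where mn: "n > 0" "q = of_int m / of_int n"
    using q(1) by (elim Rats_cases') auto
  have root: "algebraic (cis (of_int e * \<theta>))" for e :: int
  proof (rule algebraic_root_of_unity)
    have "cis (of_int e * \<theta>) ^ nat (2 * n) = cis (real (nat (2 * n)) * (of_int e * \<theta>))"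
      by (rule Complex.DeMoivre)
    also have "real (nat (2 * n)) * (of_int e * \<theta>) = 2 * pi * of_int (e * m)"
      using mn by (simp add: q(2) field_simps)
    also have "cis (2 * pi * of_int (e * m)) = 1" by (rule cis_multiple_2pi) simp
    finally show "cis (of_int e * \<theta>) ^ nat (2 * n) = 1" .
  qed (use mn in simp)
  have "algebraic ((cis \<theta> + cis (- \<theta>)) * inverse 2)"
    using root[of 1] root[of "-1"] by (intro algebraic_add_mult_complex algebraic_inverse) auto
  also have "(cis \<theta> + cis (- \<theta>)) * inverse 2 = of_real (cos \<theta>)"
    by (simp add: complex_eq_iff)
  finally show ?thesis by simp
qed

section \<open>Hyperbolic trigonometry in the disc\<close>

lemma norm_less_1_power: "z \<in> hyp_plane \<Longrightarrow> (cmod z)\<^sup>2 < 1"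
  by (simp add: hyp_plane_def power_less_one_iff)

lemma hdist_commute: "hdist z w = hdist w z"
  by (simp add: hdist_def norm_minus_commute mult.commute)

lemma cosh_hdist:
  assumes "z \<in> hyp_plane" "w \<in> hyp_plane"
  shows "cosh (hdist z w) = 1 + 2 * (cmod (z - w))\<^sup>2 / ((1 - (cmod z)\<^sup>2) * (1 - (cmod w)\<^sup>2))"
  unfolding hdist_def using norm_less_1_power[OF assms(1)] norm_less_1_power[OF assms(2)]
  by (intro cosh_arcosh_real) simp

lemma hdist_nonneg:
  assumes "z \<in> hyp_plane" "w \<in> hyp_plane"
  shows "hdist z w \<ge> 0"
  unfolding hdist_def using norm_less_1_power[OF assms(1)] norm_less_1_power[OF assms(2)]
  by (intro arcosh_nonneg_real) simp

lemma hdist_pos: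
  assumes "z \<in> hyp_plane" "w \<in> hyp_plane" "z \<noteq> w"
  shows "hdist z w > 0"
proof -
  have "cosh (hdist z w) > 1"
    unfolding cosh_hdist[OF assms(1,2)]
    using norm_less_1_power[OF assms(1)] norm_less_1_power[OF assms(2)] assms(3) by simp
  then have "hdist z w \<noteq> 0" by auto
  with hdist_nonneg[OF assms(1,2)] show ?thesis by simp
qed

definition disc_moebius :: "complex \<Rightarrow> complex \<Rightarrow> complex" where
  "disc_moebius Q z = (z - Q) / (1 - cnj Q * z)"

lemma disc_moebius_denominator_nonzero:
  assumes "Q \<in> hyp_plane" "z \<in> hyp_plane"
  shows "1 - cnj Q * z \<noteq> 0"
proof
  assume "1 - cnj Q * z = 0"
  then have "cmod (cnj Q * z) = 1" by simp
  moreover have "cmod (cnj Q * z) < 1"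
    using assms mult_strict_mono[of "cmod Q" 1 "cmod z" 1] by (simp add: norm_mult hyp_plane_def)
  ultimately show False by simp
qed

lemma one_minus_norm_disc_moebius:
  assumes "Q \<in> hyp_plane" "z \<in> hyp_plane"
  shows "1 - (cmod (disc_moebius Q z))\<^sup>2 = (1 - (cmod z)\<^sup>2) * (1 - (cmod Q)\<^sup>2) / (cmod (1 - cnj Q * z))\<^sup>2"
proof -
  have "(cmod (1 - cnj Q * z))\<^sup>2 - (cmod (z - Q))\<^sup>2 = (1 - (cmod z)\<^sup>2) * (1 - (cmod Q)\<^sup>2)"
    unfolding cmod_power2 by (simp add: power2_eq_square algebra_simps)
  moreover have "cmod (1 - cnj Q * z) \<noteq> 0" using disc_moebius_denominator_nonzero[OF assms] by simp
  ultimately show ?thesis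
    by (simp add: disc_moebius_def norm_divide power_divide field_simps)
qed

lemma disc_moebius_in_hyp_plane:
  assumes "Q \<in> hyp_plane" "z \<in> hyp_plane"
  shows "disc_moebius Q z \<in> hyp_plane"
proof -
  have "1 - (cmod (disc_moebius Q z))\<^sup>2 > 0"
    unfolding one_minus_norm_disc_moebius[OF assms]
    using norm_less_1_power[OF assms(1)] norm_less_1_power[OF assms(2)] disc_moebius_denominator_nonzero[OF assms]
    by (intro divide_pos_pos mult_pos_pos) auto
  then show ?thesis by (simp add: hyp_plane_def abs_square_less_1)
qed

text \<open>Together with \<open>one_minus_norm_disc_moebius\<close> this shows that the distance formula is invariant, as the
factors \<open>cmod (1 - cnj Q * z)\<close> cancel.\<close>

lemma norm_disc_moebius_diff:
  assumes "Q \<in> hyp_plane" "z \<in> hyp_plane" "w \<in> hyp_plane"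
  shows "cmod (disc_moebius Q z - disc_moebius Q w) =
    cmod (z - w) * (1 - (cmod Q)\<^sup>2) / (cmod (1 - cnj Q * z) * cmod (1 - cnj Q * w))"
proof -
  have "disc_moebius Q z - disc_moebius Q w = (z - w) * (1 - Q * cnj Q) / ((1 - cnj Q * z) * (1 - cnj Q * w))"
    using disc_moebius_denominator_nonzero[OF assms(1,2)] disc_moebius_denominator_nonzero[OF assms(1,3)]
    by (simp add: disc_moebius_def field_simps)
  moreover have "1 - Q * cnj Q = of_real (1 - (cmod Q)\<^sup>2)"
    by (simp flip: complex_norm_square)
  ultimately have "cmod (disc_moebius Q z - disc_moebius Q w) =
      cmod (z - w) * \<bar>1 - (cmod Q)\<^sup>2\<bar> / (cmod (1 - cnj Q * z) * cmod (1 - cnj Q * w))"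
    by (simp only: norm_divide norm_mult norm_of_real)
  then show ?thesis using norm_less_1_power[OF assms(1)] by simp
qed

lemma hdist_disc_moebius:
  assumes "Q \<in> hyp_plane" "z \<in> hyp_plane" "w \<in> hyp_plane"
  shows "hdist (disc_moebius Q z) (disc_moebius Q w) = hdist z w"
proof -
  have "1 - (cmod Q)\<^sup>2 \<noteq> 0" "cmod (1 - cnj Q * z) \<noteq> 0" "cmod (1 - cnj Q * w) \<noteq> 0"
    using norm_less_1_power[OF assms(1)] disc_moebius_denominator_nonzero assms by auto
  then show ?thesis
    unfolding hdist_def one_minus_norm_disc_moebius[OF assms(1,2)] one_minus_norm_disc_moebius[OF assms(1,3)]
      norm_disc_moebius_diff[OF assms]
    by (simp add: power_divide power_mult_distrib power2_eq_square)
qed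

lemma disc_moebius_inverse:
  assumes "Q \<in> hyp_plane" "z \<in> hyp_plane"
  shows "disc_moebius (- Q) (disc_moebius Q z) = z"
proof -
  define D where "D = 1 - cnj Q * z"
  have D: "D \<noteq> 0" unfolding D_def using assms by (rule disc_moebius_denominator_nonzero)
  have "1 - Q * cnj Q \<noteq> 0"
    using disc_moebius_denominator_nonzero[OF assms(1,1)] by (simp add: mult.commute)
  moreover have "disc_moebius Q z + Q = z * (1 - Q * cnj Q) / D" "1 + cnj Q * disc_moebius Q z = (1 - Q * cnj Q) / D"
    using D by (simp_all add: disc_moebius_def D_def field_simps)
  ultimately show ?thesis using D by (simp add: disc_moebius_def[of "- Q"])
qed

lemma cosh_sinh_hdist_disc_moebius:
  assumes "Q \<in> hyp_plane" "z \<in> hyp_plane"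
  defines "r \<equiv> cmod (disc_moebius Q z)"
  shows "cosh (hdist Q z) = (1 + r\<^sup>2) / (1 - r\<^sup>2)" "sinh (hdist Q z) = 2 * r / (1 - r\<^sup>2)"
proof -
  have r: "r\<^sup>2 < 1" "r \<ge> 0" unfolding r_def using norm_less_1_power disc_moebius_in_hyp_plane assms by auto
  have "disc_moebius Q Q = 0" by (simp add: disc_moebius_def)
  then have "hdist Q z = hdist 0 (disc_moebius Q z)"
    using hdist_disc_moebius[OF assms(1,1,2)] by simp
  then show c: "cosh (hdist Q z) = (1 + r\<^sup>2) / (1 - r\<^sup>2)"
    using r disc_moebius_in_hyp_plane[OF assms(1,2)]
    by (simp add: cosh_hdist hyp_plane_def r_def field_simps)
  have "(sinh (hdist Q z))\<^sup>2 = (2 * r / (1 - r\<^sup>2))\<^sup>2"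
  proof -
    have "((1 + r\<^sup>2) / (1 - r\<^sup>2))\<^sup>2 - 1 = ((1 + r\<^sup>2)\<^sup>2 - (1 - r\<^sup>2)\<^sup>2) / (1 - r\<^sup>2)\<^sup>2"
      using r by (simp add: power_divide diff_divide_distrib)
    also have "(1 + r\<^sup>2)\<^sup>2 - (1 - r\<^sup>2)\<^sup>2 = (2 * r)\<^sup>2"
      by (simp add: power2_eq_square algebra_simps)
    finally show ?thesis unfolding sinh_square_eq c by (simp only: power_divide)
  qed
  then show "sinh (hdist Q z) = 2 * r / (1 - r\<^sup>2)"
  proof (rule power2_eq_imp_eq)
    show "0 \<le> sinh (hdist Q z)" using hdist_nonneg[OF assms(1,2)] by simp
    show "0 \<le> 2 * r / (1 - r\<^sup>2)" using r by simp
  qed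
qed

lemma hdirection_disc_moebius: "hdirection Q P = sgn (disc_moebius Q P)"
  by (simp add: hdirection_def disc_moebius_def)

text \<open>After moving \<open>Q\<close> to the origin, the directions are those of the images \<open>u\<close> and \<open>w\<close> of \<open>P\<close> and \<open>R\<close>,
and the Euclidean law of cosines for \<open>u - w\<close> gives the hyperbolic one.\<close>

lemma hyperbolic_law_of_cosines:
  assumes "P \<in> hyp_plane" "Q \<in> hyp_plane" "R \<in> hyp_plane"
  shows "cosh (hdist P R) = cosh (hdist Q P) * cosh (hdist Q R) -
    sinh (hdist Q P) * sinh (hdist Q R) * (hdirection Q P \<bullet> hdirection Q R)"
proof -
  define u w where "u = disc_moebius Q P" and "w = disc_moebius Q R"
  have u: "u \<in> hyp_plane" and w: "w \<in> hyp_plane"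
    unfolding u_def w_def using assms by (auto intro: disc_moebius_in_hyp_plane)
  have dot: "cmod u * cmod w * (hdirection Q P \<bullet> hdirection Q R) = u \<bullet> w"
    unfolding hdirection_disc_moebius u_def[symmetric] w_def[symmetric]
  proof -
    have polar: "z = cmod z *\<^sub>R sgn z" for z by (cases "z = 0") (simp_all add: sgn_div_norm)
    have "u \<bullet> w = (cmod u *\<^sub>R sgn u) \<bullet> (cmod w *\<^sub>R sgn w)" using polar by simp
    then show "cmod u * cmod w * (sgn u \<bullet> sgn w) = u \<bullet> w" by simp
  qed
  have "cosh (hdist P R) = 1 + 2 * (cmod (u - w))\<^sup>2 / ((1 - (cmod u)\<^sup>2) * (1 - (cmod w)\<^sup>2))"
    using cosh_hdist[OF u w] hdist_disc_moebius[OF assms(2,1,3)] by (simp add: u_def w_def)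
  also have "\<dots> = ((1 + (cmod u)\<^sup>2) * (1 + (cmod w)\<^sup>2) - 4 * (u \<bullet> w)) / ((1 - (cmod u)\<^sup>2) * (1 - (cmod w)\<^sup>2))"
  proof -
    define D where "D = (1 - (cmod u)\<^sup>2) * (1 - (cmod w)\<^sup>2)"
    have "D \<noteq> 0"
      unfolding D_def using norm_less_1_power[OF u] norm_less_1_power[OF w] by simp
    then have "1 + 2 * (cmod (u - w))\<^sup>2 / D = (D + 2 * (cmod (u - w))\<^sup>2) / D"
      by (simp add: add_divide_distrib)
    moreover have "(cmod (u - w))\<^sup>2 = (cmod u)\<^sup>2 + (cmod w)\<^sup>2 - 2 * (u \<bullet> w)"
      by (simp add: power2_norm_eq_inner inner_diff inner_commute)
    moreover have "D + 2 * ((cmod u)\<^sup>2 + (cmod w)\<^sup>2 - 2 * (u \<bullet> w)) =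
        (1 + (cmod u)\<^sup>2) * (1 + (cmod w)\<^sup>2) - 4 * (u \<bullet> w)"
      by (simp add: D_def algebra_simps)
    ultimately show ?thesis by (simp only: D_def)
  qed
  also have "\<dots> = cosh (hdist Q P) * cosh (hdist Q R) -
      sinh (hdist Q P) * sinh (hdist Q R) * (hdirection Q P \<bullet> hdirection Q R)"
    unfolding cosh_sinh_hdist_disc_moebius[OF assms(2,1)] cosh_sinh_hdist_disc_moebius[OF assms(2,3)]
      u_def[symmetric] w_def[symmetric] dot[symmetric]
    by (simp add: diff_divide_distrib mult_ac)
  finally show ?thesis .
qed

lemma tanh_artanh_real:
  fixes x :: real
  assumes "\<bar>x\<bar> < 1"
  shows "tanh (artanh x) = x"
proof -
  have x: "1 + x > 0" "1 - x > 0" using assms by auto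
  have "exp (- (2 * artanh x)) = inverse ((1 + x) / (1 - x))"
    using x by (simp add: artanh_def exp_minus)
  then have "exp (- 2 * artanh x) = (1 - x) / (1 + x)" by simp
  then have "tanh (artanh x) = (1 - (1 - x) / (1 + x)) / (1 + (1 - x) / (1 + x))"
    unfolding tanh_real_altdef by simp
  also have "\<dots> = x" using x by (simp add: field_simps)
  finally show ?thesis .
qed

lemma dist_on_ray:
  fixes e :: complex
  assumes "cmod e = 1"
  shows "hdist (tanh (s / 2) *\<^sub>R e) (tanh (t / 2) *\<^sub>R e) = \<bar>s - t\<bar>"
proof -
  define x y where "x = s / 2" and "y = t / 2"
  have in_plane: "tanh u *\<^sub>R e \<in> hyp_plane" for u :: real
    using assms tanh_real_bounds[of u] by (simp add: hyp_plane_def abs_less_iff)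
  have one_minus: "1 - (tanh u)\<^sup>2 = 1 / (cosh u)\<^sup>2" for u :: real
  proof -
    have "1 / (cosh u)\<^sup>2 = ((cosh u)\<^sup>2 - (sinh u)\<^sup>2) / (cosh u)\<^sup>2"
      by (simp only: hyperbolic_pythagoras)
    then show ?thesis by (simp add: diff_divide_distrib tanh_def power_divide del: cosh_square_eq)
  qed
  have "tanh x - tanh y = sinh (x - y) / (cosh x * cosh y)"
    by (simp add: tanh_def sinh_diff field_simps)
  moreover have "cmod (tanh x *\<^sub>R e - tanh y *\<^sub>R e) = \<bar>tanh x - tanh y\<bar>"
    using assms by (simp flip: scaleR_diff_left)
  moreover have "cosh (2 * (x - y)) = 1 + 2 * (sinh (x - y))\<^sup>2"
    unfolding cosh_double using hyperbolic_pythagoras[of "x - y"] by simp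
  ultimately have "cosh (hdist (tanh x *\<^sub>R e) (tanh y *\<^sub>R e)) = cosh (2 * (x - y))"
    using assms cosh_hdist[OF in_plane in_plane]
    by (simp add: one_minus power_divide power_mult_distrib)
  then have "cosh (hdist (tanh x *\<^sub>R e) (tanh y *\<^sub>R e)) = cosh \<bar>2 * (x - y)\<bar>"
    by simp
  then have "hdist (tanh x *\<^sub>R e) (tanh y *\<^sub>R e) = \<bar>2 * (x - y)\<bar>"
    using hdist_nonneg[OF in_plane in_plane] by (metis abs_ge_zero arcosh_cosh_real)
  then show ?thesis by (simp add: x_def y_def)
qed

text \<open>After moving \<open>Q\<close> to the origin, both points lie on the diameter in direction \<open>e\<close>, which
\<open>t \<mapsto> tanh (t / 2) e\<close> parametrizes by arc length.\<close>

lemma hcollinear_if_parallel_directions: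
  assumes "P \<in> hyp_plane" "Q \<in> hyp_plane" "R \<in> hyp_plane" "P \<noteq> Q" "R \<noteq> Q"
    and parallel: "hdirection Q R = hdirection Q P \<or> hdirection Q R = - hdirection Q P"
  shows "hcollinear P Q R"
proof -
  define e where "e = hdirection Q P"
  have mQ: "- Q \<in> hyp_plane" using assms(2) by (simp add: hyp_plane_def)
  have nz: "disc_moebius Q z \<noteq> 0" if "z \<in> hyp_plane" "z \<noteq> Q" for z
    using that disc_moebius_denominator_nonzero[OF assms(2) that(1)] by (simp add: disc_moebius_def)
  have e: "cmod e = 1" using nz[OF assms(1,4)] by (simp add: e_def hdirection_disc_moebius norm_sgn)
  define \<gamma> where "\<gamma> t = disc_moebius (- Q) (tanh (t / 2) *\<^sub>R e)" for t :: real
  have in_plane: "tanh u *\<^sub>R e \<in> hyp_plane" for u :: real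
    using e tanh_real_bounds[of u] by (simp add: hyp_plane_def abs_less_iff)
  have "range \<gamma> \<subseteq> hyp_plane"
    using in_plane mQ by (auto simp: \<gamma>_def intro: disc_moebius_in_hyp_plane)
  moreover have "hdist (\<gamma> s) (\<gamma> t) = \<bar>s - t\<bar>" for s t
    unfolding \<gamma>_def using hdist_disc_moebius[OF mQ in_plane in_plane] dist_on_ray[OF e] by simp
  ultimately have "geodesic_line (range \<gamma>)" unfolding geodesic_line_def by blast
  moreover have on_line: "z \<in> range \<gamma>" if z: "z \<in> hyp_plane" and x: "disc_moebius Q z = x *\<^sub>R e" for z x
  proof -
    have "\<bar>x\<bar> < 1" using disc_moebius_in_hyp_plane[OF assms(2) z] x e by (simp add: hyp_plane_def)
    then have "\<gamma> (2 * artanh x) = disc_moebius (- Q) (disc_moebius Q z)"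
      by (simp add: \<gamma>_def tanh_artanh_real x)
    then show ?thesis using disc_moebius_inverse[OF assms(2) z] by (metis rangeI)
  qed
  have polar: "disc_moebius Q z = cmod (disc_moebius Q z) *\<^sub>R hdirection Q z" for z
    unfolding hdirection_disc_moebius by (cases "disc_moebius Q z = 0") (simp_all add: sgn_div_norm)
  have "P \<in> range \<gamma>" using on_line[OF assms(1)] polar[of P] by (simp add: e_def)
  moreover have "Q \<in> range \<gamma>" using on_line[OF assms(2), of 0] by (simp add: disc_moebius_def)
  moreover have "R \<in> range \<gamma>"
    using parallel on_line[OF assms(3), of "cmod (disc_moebius Q R)"] on_line[OF assms(3), of "- cmod (disc_moebius Q R)"]
      polar[of R] by (auto simp: e_def)
  ultimately show ?thesis unfolding hcollinear_def by blast
qed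

lemma abs_cos_angle_less_1:
  assumes "P \<in> hyp_plane" "Q \<in> hyp_plane" "R \<in> hyp_plane" "P \<noteq> Q" "R \<noteq> Q" "\<not> hcollinear P Q R"
  shows "\<bar>hdirection Q P \<bullet> hdirection Q R\<bar> < 1"
proof -
  define e f where "e = hdirection Q P" and "f = hdirection Q R"
  have "disc_moebius Q z \<noteq> 0" if "z \<in> hyp_plane" "z \<noteq> Q" for z
    using that disc_moebius_denominator_nonzero[OF assms(2) that(1)] by (simp add: disc_moebius_def)
  then have unit: "e \<bullet> e = 1" "f \<bullet> f = 1"
    using assms by (simp_all add: e_def f_def hdirection_disc_moebius norm_sgn flip: power2_norm_eq_inner)
  have "f \<noteq> e" "f \<noteq> - e"
    using hcollinear_if_parallel_directions[of P Q R] assms by (auto simp: e_def f_def)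
  then have "0 < (f - e) \<bullet> (f - e)" "0 < (f + e) \<bullet> (f + e)"
    by (auto simp: inner_gt_zero_iff eq_neg_iff_add_eq_0)
  then show ?thesis
    using unit by (simp add: inner_diff inner_add inner_commute e_def f_def abs_less_iff)
qed

text \<open>The cosine does not distinguish the internal angle from the angle between the two sides: they are equal
or add up to \<open>2 * pi\<close>.\<close>

lemma algebraic_cos_angle:
  assumes "internal_angle I P Q R \<in> rational_multiples_of_pi"
    and "\<bar>hdirection Q P \<bullet> hdirection Q R\<bar> < 1"
  shows "algebraic (hdirection Q P \<bullet> hdirection Q R)"
proof -
  have "cos (internal_angle I P Q R) = cos (hangle P Q R)"
    by (simp add: internal_angle_def cos_diff)
  also have "\<dots> = hdirection Q P \<bullet> hdirection Q R"
    using assms(2) by (simp add: hangle_def cos_arccos_abs)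
  finally show ?thesis using algebraic_cos_rational_multiple_pi[OF assms(1)] by simp
qed

section \<open>The Gram determinant of four points\<close>

text \<open>The hyperboloid model in Minkowski space, where the hyperbolic cosine of the distance becomes bilinear.\<close>

definition hyperboloid :: "complex \<Rightarrow> real \<times> real \<times> real" where
  "hyperboloid z = ((1 + (cmod z)\<^sup>2) / (1 - (cmod z)\<^sup>2), 2 * Re z / (1 - (cmod z)\<^sup>2), 2 * Im z / (1 - (cmod z)\<^sup>2))"

definition minkowski :: "real \<times> real \<times> real \<Rightarrow> real \<times> real \<times> real \<Rightarrow> real" where
  "minkowski v w = fst v * fst w - fst (snd v) * fst (snd w) - snd (snd v) * snd (snd w)"

lemma minkowski_linear:
  "minkowski (v + v') w = minkowski v w + minkowski v' w"
  "minkowski (x *\<^sub>R v) w = x * minkowski v w" "minkowski 0 w = 0"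
  by (simp_all add: minkowski_def algebra_simps)

lemma minkowski_sum:
  "minkowski (\<Sum>i\<in>I. x i *\<^sub>R v i) w = (\<Sum>i\<in>I. x i * minkowski (v i) w)"
  by (induction I rule: infinite_finite_induct) (simp_all add: minkowski_linear)

lemma minkowski_hyperboloid:
  assumes "z \<in> hyp_plane" "w \<in> hyp_plane"
  shows "minkowski (hyperboloid z) (hyperboloid w) = cosh (hdist z w)"
proof -
  define m n where "m = 1 - (cmod z)\<^sup>2" and "n = 1 - (cmod w)\<^sup>2"
  have mn: "m \<noteq> 0" "n \<noteq> 0"
    using norm_less_1_power[OF assms(1)] norm_less_1_power[OF assms(2)] by (auto simp: m_def n_def)
  have "minkowski (hyperboloid z) (hyperboloid w) =
      ((1 + (cmod z)\<^sup>2) * (1 + (cmod w)\<^sup>2) - 4 * (Re z * Re w + Im z * Im w)) / (m * n)"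
    by (simp add: minkowski_def hyperboloid_def diff_divide_distrib add_divide_distrib algebra_simps
        flip: m_def n_def)
  also have "(1 + (cmod z)\<^sup>2) * (1 + (cmod w)\<^sup>2) - 4 * (Re z * Re w + Im z * Im w) =
      m * n + 2 * (cmod (z - w))\<^sup>2"
    unfolding m_def n_def cmod_power2 by (simp add: power2_eq_square algebra_simps)
  also have "(m * n + 2 * (cmod (z - w))\<^sup>2) / (m * n) = cosh (hdist z w)"
    using mn by (simp add: cosh_hdist[OF assms] add_divide_distrib flip: m_def n_def)
  finally show ?thesis .
qed

lemma inj_on_hyperboloid: "inj_on hyperboloid hyp_plane"
proof (rule inj_onI)
  fix z w assume zw: "z \<in> hyp_plane" "w \<in> hyp_plane" "hyperboloid z = hyperboloid w"
  then have "cosh (hdist z w) = cosh (hdist z z)"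
    by (metis minkowski_hyperboloid)
  also have "\<dots> = 1" using cosh_hdist[OF zw(1,1)] by simp
  finally have "hdist z w = 0" by simp
  then show "z = w" using hdist_pos[OF zw(1,2)] by fastforce
qed

text \<open>More than three vectors in a three-dimensional space satisfy a linear relation, and pairing it with a
point of the hyperboloid expresses it by distances.\<close>

lemma hyperboloid_dependent:
  assumes fin: "finite S" and card: "card S > 3" and S: "S \<subseteq> hyp_plane"
  obtains x where "\<exists>z\<in>S. x z \<noteq> 0" "\<And>w. w \<in> hyp_plane \<Longrightarrow> (\<Sum>z\<in>S. x z * cosh (hdist z w)) = 0"
proof -
  have inj: "inj_on hyperboloid S" using inj_on_hyperboloid S by (rule inj_on_subset)
  have "dependent (hyperboloid ` S)"
    by (rule dependent_biggerset) (use fin card card_image[OF inj] in simp)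
  then obtain u where u: "\<exists>v\<in>hyperboloid ` S. u v \<noteq> 0" "(\<Sum>v\<in>hyperboloid ` S. u v *\<^sub>R v) = 0"
    using fin by (auto simp: dependent_finite)
  have "(\<Sum>z\<in>S. u (hyperboloid z) * cosh (hdist z w)) = 0" if "w \<in> hyp_plane" for w
  proof -
    have "(\<Sum>z\<in>S. u (hyperboloid z) * cosh (hdist z w)) =
        (\<Sum>z\<in>S. u (hyperboloid z) * minkowski (hyperboloid z) (hyperboloid w))"
      using S that by (intro sum.cong) (auto simp: minkowski_hyperboloid)
    also have "\<dots> = minkowski (\<Sum>v\<in>hyperboloid ` S. u v *\<^sub>R v) (hyperboloid w)"
      by (simp add: minkowski_sum sum.reindex[OF inj])
    finally show ?thesis by (simp add: u(2) minkowski_linear)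
  qed
  with u(1) that[of "\<lambda>z. u (hyperboloid z)"] show ?thesis by auto
qed

lemma singular_symmetric_2x2:
  fixes s t :: real
  assumes "s * a + t * b = 0" "s * b + t * d = 0" "s \<noteq> 0 \<or> t \<noteq> 0"
  shows "a * d = b\<^sup>2"
proof -
  have "s * (a * d - b\<^sup>2) = d * (s * a + t * b) - b * (s * b + t * d)"
    "t * (a * d - b\<^sup>2) = a * (s * b + t * d) - b * (s * a + t * b)"
    by (simp_all add: power2_eq_square algebra_simps)
  then have "s * (a * d - b\<^sup>2) = 0" "t * (a * d - b\<^sup>2) = 0" using assms(1,2) by simp_all
  with assms(3) show ?thesis by auto
qed

text \<open>The matrix of the numbers \<open>cosh (hdist z w)\<close> for the four points is singular, and if opposite
sides agree it is invariant under exchanging \<open>A\<close> with \<open>C\<close> and \<open>B\<close> with \<open>D\<close>. So it splits into two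
symmetric blocks of size two, on the vectors that are invariant (\<open>e = 1\<close>) and on those that change
sign (\<open>e = -1\<close>), and one of the blocks is singular. Geometrically \<open>e = 1\<close> is the case of a parallelogram, with
a half-turn as symmetry, and \<open>e = -1\<close> that of a crossed quadrilateral with an axis of symmetry.\<close>

lemma equal_opposite_sides_gram:
  assumes plane: "A \<in> hyp_plane" "B \<in> hyp_plane" "C \<in> hyp_plane" "D \<in> hyp_plane"
    and dist: "distinct [A, B, C, D]"
    and sides: "hdist A B = hdist C D" "hdist B C = hdist D A"
  obtains e :: real where "e \<in> {1, -1}"
    "(cosh (hdist A C) + e) * (cosh (hdist B D) + e) = (cosh (hdist A B) + e * cosh (hdist B C))\<^sup>2"
proof -
  define p q X Y where "p = cosh (hdist A C)" and "q = cosh (hdist B D)"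
    and "X = cosh (hdist A B)" and "Y = cosh (hdist B C)"
  have "finite {A, B, C, D}" "card {A, B, C, D} > 3" "{A, B, C, D} \<subseteq> hyp_plane"
    using plane dist by auto
  then obtain x where nz: "\<exists>z\<in>{A, B, C, D}. x z \<noteq> 0"
    and x: "\<And>w. w \<in> hyp_plane \<Longrightarrow> (\<Sum>z\<in>{A, B, C, D}. x z * cosh (hdist z w)) = 0"
    by (rule hyperboloid_dependent) blast
  have self: "cosh (hdist z z) = 1" if "z \<in> hyp_plane" for z
    using cosh_hdist[OF that that] by simp
  have "x A * 1 + x B * X + x C * p + x D * Y = 0"
    using x[OF plane(1)] dist self[OF plane(1)] sides
    by (simp add: p_def q_def X_def Y_def hdist_commute)
  moreover have "x A * X + x B * 1 + x C * Y + x D * q = 0"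
    using x[OF plane(2)] dist self[OF plane(2)] sides
    by (simp add: p_def q_def X_def Y_def hdist_commute)
  moreover have "x A * p + x B * Y + x C * 1 + x D * X = 0"
    using x[OF plane(3)] dist self[OF plane(3)] sides
    by (simp add: p_def q_def X_def Y_def hdist_commute)
  moreover have "x A * Y + x B * q + x C * X + x D * 1 = 0"
    using x[OF plane(4)] dist self[OF plane(4)] sides
    by (simp add: p_def q_def X_def Y_def hdist_commute)
  ultimately have plus: "(x A + x C) * (p + 1) + (x B + x D) * (X + Y) = 0"
      "(x A + x C) * (X + Y) + (x B + x D) * (q + 1) = 0"
    and minus: "(x A - x C) * (p - 1) + (x D - x B) * (X - Y) = 0"
      "(x A - x C) * (X - Y) + (x D - x B) * (q - 1) = 0"
    by (simp_all add: algebra_simps)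
  show ?thesis
  proof (cases "x A + x C = 0 \<and> x B + x D = 0")
    case False
    then have "(p + 1) * (q + 1) = (X + Y)\<^sup>2" using plus by (intro singular_symmetric_2x2) auto
    then show ?thesis by (intro that[of 1]) (auto simp: p_def q_def X_def Y_def)
  next
    case True
    then have "x A - x C \<noteq> 0 \<or> x D - x B \<noteq> 0" using nz by auto
    then have "(p - 1) * (q - 1) = (X - Y)\<^sup>2" using minus by (intro singular_symmetric_2x2) auto
    then show ?thesis by (intro that[of "-1"]) (auto simp: p_def q_def X_def Y_def)
  qed
qed

section \<open>Sides and angles that satisfy an algebraic relation\<close>

lemma product_to_sum_law_of_cosines:
  "2 * (cosh a * cosh b - sinh a * sinh b * k) = (1 - k) * cosh (a + b) + (1 + k) * cosh (a - b)"
  for a b k :: real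
  by (simp add: cosh_add cosh_diff algebra_simps)

text \<open>Two triangles share a side; \<open>a\<close>, \<open>b\<close> and \<open>c\<close>, \<open>d\<close> are their other sides and \<open>k\<close>, \<open>l\<close> the cosines
of the angles opposite to the shared side. Expressing its hyperbolic cosine in both triangles gives a
relation between the hyperbolic cosines of \<open>a + b\<close>, \<open>a - b\<close>, \<open>c + d\<close> and \<open>c - d\<close> with nonzero
algebraic coefficients. If the sides are algebraic, the terms on the two sides must match.\<close>

lemma common_diagonal_sides_agree:
  fixes a b c d k l :: real
  assumes alg: "algebraic a" "algebraic b" "algebraic c" "algebraic d" "algebraic k" "algebraic l"
    and pos: "a > 0" "b > 0" "c > 0" "d > 0" and kl: "\<bar>k\<bar> < 1" "\<bar>l\<bar> < 1"
    and eq: "cosh a * cosh b - sinh a * sinh b * k = cosh c * cosh d - sinh c * sinh d * l"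
  shows "a + b = c + d" "\<bar>a - b\<bar> = \<bar>c - d\<bar>" "k = l"
proof -
  have subst: "(1 - k) * g (a + b) + (1 + k) * g (a - b) = (1 - l) * g (c + d) + (1 + l) * g (c - d)"
    if even: "\<And>x. g (- x) = g x" for g :: "real \<Rightarrow> real"
  proof -
    have "(\<Sum>(k, s)\<leftarrow>[(1 - k, a + b), (1 + k, a - b), (l - 1, c + d), (- 1 - l, c - d)]. k * g s) = 0"
    proof (rule cosh_relation_substitute)
      show "(\<Sum>(k, s)\<leftarrow>[(1 - k, a + b), (1 + k, a - b), (l - 1, c + d), (- 1 - l, c - d)]. k * cosh s) = 0"
        using eq product_to_sum_law_of_cosines[of a b k] product_to_sum_law_of_cosines[of c d l]
        by (simp add: algebra_simps)
    qed (use alg even in \<open>auto intro: algebraic_add_mult_real algebraic_diff_real\<close>)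
    then show ?thesis by (simp add: algebra_simps)
  qed
  define g where "g r x = (if \<bar>x\<bar> = r then 1 else 0 :: real)" for r x :: real
  have rel: "(1 - k) * g r (a + b) + (1 + k) * g r (a - b) = (1 - l) * g r (c + d) + (1 + l) * g r (c - d)" for r
    by (rule subst) (simp add: g_def)
  have lt: "\<bar>a - b\<bar> < a + b" "\<bar>c - d\<bar> < c + d" using pos by auto
  \<comment> \<open>If they differed, the larger one would occur on one side only, with a positive coefficient.\<close>
  show sum: "a + b = c + d"
    using rel[of "a + b"] rel[of "c + d"] lt kl pos by (auto simp: g_def split: if_splits)
  show "k = l"
    using rel[of "a + b"] sum lt pos by (auto simp: g_def split: if_splits)
  show "\<bar>a - b\<bar> = \<bar>c - d\<bar>"
    using rel[of "\<bar>a - b\<bar>"] sum lt kl pos by (auto simp: g_def split: if_splits)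
qed

text \<open>In terms of \<open>P\<close> and \<open>M\<close> the relation is the quadratic equation \<open>(u P - v M) (P - M) = 0\<close>, since
\<open>(1 + k) (1 - l) + (1 - k) (1 + l) = 4 - (u + v)\<close>. As \<open>P\<close> and \<open>M\<close> differ, \<open>u P = v M\<close>, where \<open>u\<close> and
\<open>v\<close> are nonzero. This is a relation between \<open>cosh (a + b)\<close>, \<open>cosh (a - b)\<close> and \<open>cosh 0\<close> with algebraic
coefficients, and the first of these is linearly independent of the other two.\<close>

lemma singular_gram_not_algebraic:
  fixes a b k l e :: real
  assumes alg: "algebraic a" "algebraic b" "algebraic k" "algebraic l"
    and pos: "a > 0" "b > 0" and kl: "\<bar>k\<bar> < 1" "\<bar>l\<bar> < 1" and e: "e \<in> {1, -1}"
    and gram: "(cosh a * cosh b - sinh a * sinh b * k + e) * (cosh a * cosh b - sinh a * sinh b * l + e) =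
      (cosh a + e * cosh b)\<^sup>2"
  shows False
proof -
  define P M where "P = cosh (a + b) + e" and "M = cosh (a - b) + e"
  define u v where "u = (1 - k) * (1 - l)" and "v = (1 + k) * (1 + l)"
  have e2: "e * e = 1" using e by auto
  have double: "2 * (cosh a * cosh b - sinh a * sinh b * k + e) = (1 - k) * P + (1 + k) * M"
    "2 * (cosh a * cosh b - sinh a * sinh b * l + e) = (1 - l) * P + (1 + l) * M"
    unfolding P_def M_def distrib_left product_to_sum_law_of_cosines by (simp_all add: algebra_simps)
  have square: "(cosh a + e * cosh b)\<^sup>2 = P * M"
  proof -
    have "P * M = (cosh a * cosh b)\<^sup>2 - (sinh a)\<^sup>2 * (sinh b)\<^sup>2 + 2 * e * (cosh a * cosh b) + e * e"
      by (simp add: P_def M_def cosh_add cosh_diff power2_eq_square algebra_simps)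
    also have "\<dots> = (cosh a)\<^sup>2 + (cosh b)\<^sup>2 + 2 * e * (cosh a * cosh b)"
      by (simp add: sinh_square_eq power_mult_distrib e2 algebra_simps)
    also have "\<dots> = (cosh a)\<^sup>2 + e * e * (cosh b)\<^sup>2 + 2 * e * (cosh a * cosh b)" by (simp add: e2)
    also have "\<dots> = (cosh a + e * cosh b)\<^sup>2" by (simp add: power2_eq_square algebra_simps)
    finally show ?thesis ..
  qed
  have four: "2 * x * (2 * y) = 4 * (x * y)" for x y :: real by simp
  have "((1 - k) * P + (1 + k) * M) * ((1 - l) * P + (1 + l) * M) = 4 * (P * M)"
    unfolding double[symmetric] four gram square ..
  then have "(u * P - v * M) * (P - M) = 0"
    by (simp add: u_def v_def algebra_simps)
  moreover have "P \<noteq> M"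
    using pos by (simp add: P_def M_def cosh_add cosh_diff)
  ultimately have "u * P - v * M = 0" by simp
  then have zero: "(\<Sum>(k, s)\<leftarrow>[(u, a + b), (- v, a - b), (e * (u - v), 0)]. k * cosh s) = 0"
    by (simp add: P_def M_def algebra_simps)
  define g where "g x = (if \<bar>x\<bar> = a + b then 1 else 0 :: real)" for x :: real
  have "algebraic u" "algebraic v" "algebraic e"
    using alg e unfolding u_def v_def
    by (auto intro!: algebraic_add_mult_real algebraic_diff_real)
  then have "(\<Sum>(k, s)\<leftarrow>[(u, a + b), (- v, a - b), (e * (u - v), 0)]. k * g s) = 0"
    using alg by (intro cosh_relation_substitute[OF _ zero])
      (auto simp: g_def intro!: algebraic_add_mult_real algebraic_diff_real)
  then have "u = 0" using pos by (auto simp: g_def split: if_splits)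
  then show False using kl by (auto simp: u_def)
qed

theorem theorem3p1:
  fixes A B C D :: complex
  assumes "A \<in> hyp_plane" "B \<in> hyp_plane" "C \<in> hyp_plane" "D \<in> hyp_plane"
    and "simple_quad A B C D"
    and "nondegenerate_quad A B C D"
    and "internal_angle (quad_interior A B C D) D A B \<in> rational_multiples_of_pi"
    and "internal_angle (quad_interior A B C D) A B C \<in> rational_multiples_of_pi"
    and "internal_angle (quad_interior A B C D) B C D \<in> rational_multiples_of_pi"
    and "internal_angle (quad_interior A B C D) C D A \<in> rational_multiples_of_pi"
  shows "transcendental (hdist A B) \<or> transcendental (hdist B C) \<or>
         transcendental (hdist C D) \<or> transcendental (hdist D A)"
proof (rule ccontr)
  define a b c d where "a = hdist A B" and "b = hdist B C" and "c = hdist C D" and "d = hdist D A"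
  assume "\<not> ?thesis"
  then have alg: "algebraic a" "algebraic b" "algebraic c" "algebraic d"
    by (simp_all add: a_def b_def c_def d_def)
  note plane = assms(1-4)
  have dist: "distinct [A, B, C, D]" using assms(5) by (simp add: simple_quad_def)
  have pos: "a > 0" "b > 0" "c > 0" "d > 0"
    using dist plane by (auto simp: a_def b_def c_def d_def intro!: hdist_pos)
  have sides: "hdist A B = a" "hdist B A = a" "hdist B C = b" "hdist C B = b"
    "hdist C D = c" "hdist D C = c" "hdist D A = d" "hdist A D = d"
    by (simp_all add: a_def b_def c_def d_def hdist_commute)
  define \<alpha> \<beta> \<gamma> \<delta> where "\<alpha> = hdirection A D \<bullet> hdirection A B" and "\<beta> = hdirection B A \<bullet> hdirection B C"
    and "\<gamma> = hdirection C B \<bullet> hdirection C D" and "\<delta> = hdirection D C \<bullet> hdirection D A"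
  have lt: "\<bar>\<alpha>\<bar> < 1" "\<bar>\<beta>\<bar> < 1" "\<bar>\<gamma>\<bar> < 1" "\<bar>\<delta>\<bar> < 1"
    using plane dist assms(6) unfolding \<alpha>_def \<beta>_def \<gamma>_def \<delta>_def nondegenerate_quad_def
    by (auto intro!: abs_cos_angle_less_1)
  have alg_cos: "algebraic \<alpha>" "algebraic \<beta>" "algebraic \<gamma>" "algebraic \<delta>"
    using lt assms(7-10) unfolding \<alpha>_def \<beta>_def \<gamma>_def \<delta>_def by (auto intro: algebraic_cos_angle)
  have BD: "cosh (hdist B D) = cosh d * cosh a - sinh d * sinh a * \<alpha>"
    "cosh (hdist B D) = cosh b * cosh c - sinh b * sinh c * \<gamma>"
    using hyperbolic_law_of_cosines[of D A B] hyperbolic_law_of_cosines[of B C D] plane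
    by (simp_all add: sides \<alpha>_def \<gamma>_def hdist_commute)
  have AC: "cosh (hdist A C) = cosh a * cosh b - sinh a * sinh b * \<beta>"
    "cosh (hdist A C) = cosh c * cosh d - sinh c * sinh d * \<delta>"
    using hyperbolic_law_of_cosines[of A B C] hyperbolic_law_of_cosines[of C D A] plane
    by (simp_all add: sides \<beta>_def \<delta>_def hdist_commute)
  have "d + a = b + c" "\<bar>d - a\<bar> = \<bar>b - c\<bar>"
    using BD by (intro common_diagonal_sides_agree[of d a b c \<alpha> \<gamma>] alg alg_cos pos lt; simp)+
  moreover have "a + b = c + d" "\<bar>a - b\<bar> = \<bar>c - d\<bar>"
    using AC by (intro common_diagonal_sides_agree[of a b c d \<beta> \<delta>] alg alg_cos pos lt; simp)+
  ultimately have opposite: "c = a" "d = b" by linarith+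
  obtain e where e: "e \<in> {1, -1 :: real}"
    "(cosh (hdist A C) + e) * (cosh (hdist B D) + e) = (cosh a + e * cosh b)\<^sup>2"
    using equal_opposite_sides_gram[OF plane dist] sides opposite by metis
  have "(cosh a * cosh b - sinh a * sinh b * \<beta> + e) * (cosh a * cosh b - sinh a * sinh b * \<alpha> + e) =
      (cosh a + e * cosh b)\<^sup>2"
    using e(2) AC(1) BD(1) opposite by (simp add: mult.commute)
  then show False
    using singular_gram_not_algebraic[of a b \<beta> \<alpha> e] alg alg_cos pos lt e(1) by blast
qed

end
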